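(* There exists an absolute constant $C>0$ such that the following holds. Let $n\ge 1$ and let $A=(a_{ij})$ be an $n\times n$ random matrix whose entries are independent and identically distributed real random variables with $\mathbb{E}a_{ij}=0$ and $\mathbb{E}a_{ij}^2=1$. Then for every $\varepsilon>0$, \[ \mathbb{P}\left(s_n(A) > \frac{1}{\varepsilon^2}\, n^{-\frac12}\right) \le C\varepsilon + \frac{C}{\sqrt{n}}. \]
   Context: For an $n\times n$ real matrix $A$, the singular values $s_1(A)\ge s_2(A)\ge\dots\ge s_n(A)$ are the eigenvalues of $\sqrt{A^{*}A}$ arranged in non-increasing order; in particular $s_n(A)$ is the smallest singular value, $s_n(A)=\min_{\|x\|_2=1}\|Ax\|_2$. *)

theory Defs
  imports "HOL-Probability.Probability"
begin

definition smallest_singular_value :: "nat \<Rightarrow> (nat \<Rightarrow> nat \<Rightarrow> real) \<Rightarrow> real" where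
  "smallest_singular_value n A =
     Inf {sqrt (\<Sum>i<n. (\<Sum>j<n. A i j * x j)^2) | x :: nat \<Rightarrow> real. (\<Sum>j<n. (x j)^2) = 1}"

definition iid_matrix_measure :: "nat \<Rightarrow> real measure \<Rightarrow> (nat \<times> nat \<Rightarrow> real) measure" where
  "iid_matrix_measure n \<mu> = PiM ({..<n} \<times> {..<n}) (\<lambda>_. \<mu>)"

end

theory Submission
  imports Defs
begin

text \<open>Write the matrix as its first two columns and the block \<open>A'\<close> of the others, and put
  \<open>\<eta> = X\<^sub>0 - X\<^sub>1\<close>, whose law is invariant under sign changes and permutations of coordinates. A ridge
  regression of \<open>\<eta>\<close> on the columns of \<open>A'\<close>, with coefficients \<open>\<beta> = \<Sum>\<^sub>j \<eta>\<^sub>j w\<^sub>j\<close>, gives the test vector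
  \<open>(1, -1, -\<beta>)\<close>, which the matrix maps to the residual. We may assume \<open>|A' v|\<^sup>2 \<ge> t |v|\<^sup>2\<close> with
  \<open>t = 1 / (\<epsilon>\<^sup>4 n)\<close>, since otherwise the smallest singular value is already small. Then the residual
  operator has squared Hilbert-Schmidt norm at most 3, so by symmetry the squared residual is of
  order \<open>|\<eta>|\<^sup>2 / n\<close>. For the lower bound on \<open>|\<beta>|\<^sup>2\<close>, the diagonal part \<open>\<Sum>\<^sub>j \<eta>\<^sub>j\<^sup>2 |w\<^sub>j|\<^sup>2\<close> is at least
  \<open>\<epsilon>\<^sup>3 |\<eta>|\<^sup>2 / 2\<close> up to the weight of \<open>\<eta>\<close> on the indices with \<open>|w\<^sub>j|\<^sup>2 \<le> \<epsilon>\<^sup>3\<close>, and the off-diagonal part is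
  controlled by \<open>\<parallel>(\<langle>w\<^sub>i, w\<^sub>j\<rangle>)\<parallel> \<le> 1 / t\<close>. A row-deletion argument bounds the probability that three given
  indices are all short by \<open>36 \<epsilon>\<^sup>3\<close>; it is the only place where the moments of the entries enter, and
  since \<open>\<eta>\<close> is always compared with its own norm, no anti-concentration of the entries is needed.\<close>

section \<open>Ridge regression over finite index sets\<close>

lemma underdetermined_system:
  fixes a :: "'i \<Rightarrow> 'j \<Rightarrow> real"
  assumes "finite I" "finite J" "card I < card J"
  shows "\<exists>x. (\<exists>j\<in>J. x j \<noteq> 0) \<and> (\<forall>i\<in>I. (\<Sum>j\<in>J. a i j * x j) = 0)"
  using assms
proof (induction I arbitrary: J a rule: finite_induct)
  case empty
  then obtain j where "j \<in> J" by fastforce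
  then show ?case by (intro exI[of _ "\<lambda>_. 1"]) auto
next
  case (insert i I)
  show ?case
  proof (cases "\<forall>j\<in>J. a i j = 0")
    case True
    have "card I < card J" using insert by simp
    from insert.IH[OF insert.prems(1) this, of a] obtain x
      where "\<exists>j\<in>J. x j \<noteq> 0" "\<forall>i\<in>I. (\<Sum>j\<in>J. a i j * x j) = 0" by blast
    then show ?thesis using True by (intro exI[of _ x]) auto
  next
    case False
    then obtain j0 where j0: "j0 \<in> J" "a i j0 \<noteq> 0" by blast
    let ?J = "J - {j0}"
    have fin: "finite ?J" using insert by simp
    have "card I < card ?J" using insert j0 by simp
    \<comment> \<open>Gaussian elimination with pivot \<open>a i j0\<close>: the remaining equations
      become a system in the unknowns \<open>?J\<close>. The value \<open>- s / a i j0\<close> at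
      \<open>j0\<close> then restores equation \<open>i\<close>.\<close>
    from insert.IH[OF fin this, of "\<lambda>k j. a k j - a k j0 * a i j / a i j0"] obtain x
      where x: "\<exists>j\<in>?J. x j \<noteq> 0"
        "\<forall>k\<in>I. (\<Sum>j\<in>?J. (a k j - a k j0 * a i j / a i j0) * x j) = 0" by blast
    define s where "s = (\<Sum>j\<in>?J. a i j * x j)"
    define z where "z = x(j0 := - s / a i j0)"
    have z_sum: "(\<Sum>j\<in>J. a k j * z j) = - a k j0 * s / a i j0 + (\<Sum>j\<in>?J. a k j * x j)" for k
    proof -
      have "(\<Sum>j\<in>J. a k j * z j) = a k j0 * z j0 + (\<Sum>j\<in>?J. a k j * z j)"
        using insert j0 by (simp add: sum.remove)
      also have "(\<Sum>j\<in>?J. a k j * z j) = (\<Sum>j\<in>?J. a k j * x j)"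
        by (intro sum.cong) (auto simp: z_def)
      finally show ?thesis by (simp add: z_def)
    qed
    have "(\<Sum>j\<in>J. a k j * z j) = 0" if "k \<in> I" for k
    proof -
      have "0 = (\<Sum>j\<in>?J. a k j * x j - a k j0 / a i j0 * (a i j * x j))"
        using x(2) that by (simp add: left_diff_distrib mult.assoc)
      also have "\<dots> = (\<Sum>j\<in>?J. a k j * x j) - a k j0 / a i j0 * s"
        by (simp add: sum_subtractf sum_distrib_left s_def)
      finally show ?thesis unfolding z_sum by simp
    qed
    moreover have "(\<Sum>j\<in>J. a i j * z j) = 0"
      unfolding z_sum using j0 by (simp add: s_def)
    moreover have "\<exists>j\<in>J. z j \<noteq> 0" using x(1) by (auto simp: z_def)
    ultimately show ?thesis by (intro exI[of _ z]) auto
  qed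
qed

text \<open>The right-hand side is appended as the column of an extra unknown \<open>None\<close>,
  with coefficients \<open>- b i\<close>. The homogeneous system has more unknowns than equations,
  injectivity forces a nonzero value at \<open>None\<close>, and dividing by that value gives a
  solution.\<close>

lemma injective_system_solvable:
  fixes a :: "'i \<Rightarrow> 'i \<Rightarrow> real"
  assumes fin: "finite I"
    and inj: "\<And>x. (\<And>i. i \<in> I \<Longrightarrow> (\<Sum>j\<in>I. a i j * x j) = 0) \<Longrightarrow> (\<And>i. i \<in> I \<Longrightarrow> x i = 0)"
  shows "\<exists>x. \<forall>i\<in>I. (\<Sum>j\<in>I. a i j * x j) = b i"
proof -
  let ?J = "insert None (Some ` I)"
  define a' where "a' i j = (case j of None \<Rightarrow> - b i | Some k \<Rightarrow> a i k)" for i j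
  have "card I < card ?J" using fin by (simp add: card_image)
  from underdetermined_system[OF fin _ this, of a'] fin obtain z
    where z: "\<exists>j\<in>?J. z j \<noteq> 0" "\<forall>i\<in>I. (\<Sum>j\<in>?J. a' i j * z j) = 0" by auto
  have eq: "(\<Sum>j\<in>I. a i j * z (Some j)) = b i * z None" if "i \<in> I" for i
  proof -
    have "0 = (\<Sum>j\<in>?J. a' i j * z j)" using z(2) that by simp
    also have "\<dots> = - b i * z None + (\<Sum>j\<in>Some ` I. a' i j * z j)"
      using fin by (subst sum.insert) (auto simp: a'_def)
    also have "(\<Sum>j\<in>Some ` I. a' i j * z j) = (\<Sum>j\<in>I. a i j * z (Some j))"
      by (subst sum.reindex) (auto simp: a'_def)
    finally show ?thesis by simp
  qed
  have "z None \<noteq> 0"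
  proof
    assume "z None = 0"
    then have "z (Some i) = 0" if "i \<in> I" for i
      using inj[of "\<lambda>j. z (Some j)", OF _ that] eq by simp
    then show False using z(1) \<open>z None = 0\<close> by auto
  qed
  then have "(\<Sum>j\<in>I. a i j * (z (Some j) / z None)) = b i" if "i \<in> I" for i
    using eq[OF that] by (simp flip: sum_divide_distrib)
  then show ?thesis by (intro exI[of _ "\<lambda>j. z (Some j) / z None"]) blast
qed

section \<open>The ridge operator, its inverse and the residual operator\<close>

locale ridge =
  fixes N :: "'a set" and C :: "'b set" and A :: "'a \<Rightarrow> 'b \<Rightarrow> real" and lam t :: real
  assumes finN: "finite N" and finC: "finite C" and lam_pos: "lam > 0" and t: "t > 0"
    and coercive: "t * (\<Sum>k\<in>C. (v k)\<^sup>2) \<le> (\<Sum>i\<in>N. (\<Sum>k\<in>C. A i k * v k)\<^sup>2)"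
begin

definition mv :: "('b \<Rightarrow> real) \<Rightarrow> 'a \<Rightarrow> real" where
  "mv v i = (\<Sum>k\<in>C. A i k * v k)"

text \<open>The regularised normal operator \<open>A^T A + lam I\<close>.\<close>

definition H :: "('b \<Rightarrow> real) \<Rightarrow> 'b \<Rightarrow> real" where
  "H v k = (\<Sum>i\<in>N. A i k * mv v i) + lam * v k"

lemma mv_sum: "finite J \<Longrightarrow> mv (\<lambda>k. \<Sum>j\<in>J. x j * f j k) i = (\<Sum>j\<in>J. x j * mv (f j) i)"
  unfolding mv_def by (simp add: sum_distrib_left sum.swap[of _ C] algebra_simps)

lemma H_sum: "finite J \<Longrightarrow> H (\<lambda>k. \<Sum>j\<in>J. x j * f j k) k = (\<Sum>j\<in>J. x j * H (f j) k)"
  unfolding H_def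
  by (simp add: mv_sum sum_distrib_left sum.distrib sum.swap[of _ N] algebra_simps)

lemma mv_diff: "mv (\<lambda>k. u k - v k) i = mv u i - mv v i"
  unfolding mv_def by (simp add: right_diff_distrib sum_subtractf)

lemma H_diff: "H (\<lambda>k. u k - v k) k = H u k - H v k"
  unfolding H_def by (simp add: mv_diff right_diff_distrib sum_subtractf)

lemma H_inner: "(\<Sum>k\<in>C. H u k * v k) = (\<Sum>i\<in>N. mv u i * mv v i) + lam * (\<Sum>k\<in>C. u k * v k)"
proof -
  have "(\<Sum>k\<in>C. (\<Sum>i\<in>N. A i k * mv u i) * v k) = (\<Sum>i\<in>N. mv u i * mv v i)"
    unfolding mv_def[of v] by (simp add: sum_distrib_left sum_distrib_right sum.swap[of _ N] algebra_simps)
  then show ?thesis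
    unfolding H_def by (simp add: sum.distrib distrib_right sum_distrib_left algebra_simps)
qed

lemma H_sym: "(\<Sum>k\<in>C. H u k * v k) = (\<Sum>k\<in>C. u k * H v k)"
  using H_inner[of u v] H_inner[of v u] by (simp add: mult.commute)

lemma H_energy: "t * (\<Sum>k\<in>C. (v k)\<^sup>2) \<le> (\<Sum>k\<in>C. H v k * v k)"
proof -
  have "t * (\<Sum>k\<in>C. (v k)\<^sup>2) \<le> (\<Sum>i\<in>N. (mv v i)\<^sup>2)" unfolding mv_def by (rule coercive)
  also have "\<dots> \<le> (\<Sum>i\<in>N. mv v i * mv v i) + lam * (\<Sum>k\<in>C. v k * v k)"
    using lam_pos by (simp add: power2_eq_square sum_nonneg)
  finally show ?thesis unfolding H_inner .
qed

text \<open>Cauchy-Schwarz applied to \<open>H_energy\<close>. It makes \<open>H\<close> injective,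
  hence invertible, with an inverse of norm at most \<open>1 / t\<close>.\<close>

lemma H_bound: "t\<^sup>2 * (\<Sum>k\<in>C. (v k)\<^sup>2) \<le> (\<Sum>k\<in>C. (H v k)\<^sup>2)"
proof (cases "(\<Sum>k\<in>C. (v k)\<^sup>2) = 0")
  case True
  then show ?thesis by (simp add: sum_nonneg)
next
  case False
  then have pos: "(\<Sum>k\<in>C. (v k)\<^sup>2) > 0" by (simp add: less_le sum_nonneg)
  have "(t * (\<Sum>k\<in>C. (v k)\<^sup>2))\<^sup>2 \<le> (\<Sum>k\<in>C. H v k * v k)\<^sup>2"
    using H_energy pos t by (intro power_mono) auto
  also have "\<dots> \<le> (\<Sum>k\<in>C. (H v k)\<^sup>2) * (\<Sum>k\<in>C. (v k)\<^sup>2)"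
    by (rule Cauchy_Schwarz_ineq_sum)
  finally have "(t\<^sup>2 * (\<Sum>k\<in>C. (v k)\<^sup>2)) * (\<Sum>k\<in>C. (v k)\<^sup>2)
      \<le> (\<Sum>k\<in>C. (H v k)\<^sup>2) * (\<Sum>k\<in>C. (v k)\<^sup>2)"
    by (simp add: power2_eq_square algebra_simps)
  then show ?thesis using pos by simp
qed

lemma H_matrix: "k \<in> C \<Longrightarrow>
  H v k = (\<Sum>l\<in>C. ((\<Sum>i\<in>N. A i k * A i l) + (if l = k then lam else 0)) * v l)"
  unfolding H_def mv_def using finC
  by (simp add: distrib_right sum.distrib sum_distrib_left sum_distrib_right sum.swap[of _ N]
      if_distrib[of "\<lambda>c. c * _"] mult.assoc cong: if_cong)

lemma H_surj: "\<exists>v. \<forall>k\<in>C. H v k = b k"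
proof -
  have "v k = 0" if "\<And>k. k \<in> C \<Longrightarrow> H v k = 0" "k \<in> C" for v k
  proof -
    have "t\<^sup>2 * (\<Sum>k\<in>C. (v k)\<^sup>2) \<le> 0" using H_bound[of v] that by simp
    then have "(\<Sum>k\<in>C. (v k)\<^sup>2) \<le> 0"
      using t by (simp add: mult_le_0_iff)
    then have "(\<Sum>k\<in>C. (v k)\<^sup>2) = 0" by (simp add: antisym sum_nonneg)
    then show ?thesis using that finC by (simp add: sum_nonneg_eq_0_iff)
  qed
  then have "\<exists>v. \<forall>k\<in>C. (\<Sum>l\<in>C. ((\<Sum>i\<in>N. A i k * A i l) + (if l = k then lam else 0)) * v l) = b k"
    by (intro injective_system_solvable[OF finC]) (simp add: H_matrix)
  then show ?thesis by (simp add: H_matrix)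
qed

definition g :: "('b \<Rightarrow> real) \<Rightarrow> 'b \<Rightarrow> real" where
  "g b = (SOME v. \<forall>k\<in>C. H v k = b k)"

lemma H_g: "k \<in> C \<Longrightarrow> H (g b) k = b k"
  using someI_ex[OF H_surj[of b]] unfolding g_def by blast

text \<open>Column \<open>j\<close> of the ridge pseudo-inverse \<open>H^-1 A^T\<close>. Only its
  values on \<open>C\<close> are determined; \<open>Q\<close> is the Gram matrix of these
  columns.\<close>

definition w :: "'a \<Rightarrow> 'b \<Rightarrow> real" where
  "w j = g (A j)"

definition Q :: "'a \<Rightarrow> 'a \<Rightarrow> real" where
  "Q i j = (\<Sum>k\<in>C. w i k * w j k)"

text \<open>Column \<open>j\<close> of the residual operator \<open>I - A H^-1 A^T\<close>: what
  ridge regression on the columns of \<open>A\<close> leaves of the unit vector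
  \<open>j\<close>.\<close>

definition p :: "'a \<Rightarrow> 'a \<Rightarrow> real" where
  "p j i = (if i = j then 1 else 0) - mv (w j) i"

lemma H_w: "k \<in> C \<Longrightarrow> H (w j) k = A j k"
  unfolding w_def by (rule H_g)

lemma mv_w: "mv v j = (\<Sum>k\<in>C. w j k * H v k)"
  unfolding H_sym[symmetric] mv_def by (simp add: H_w)

lemma p_normal: "j \<in> N \<Longrightarrow> k \<in> C \<Longrightarrow> (\<Sum>i\<in>N. A i k * p j i) = lam * w j k"
proof -
  assume jk: "j \<in> N" "k \<in> C"
  have "(\<Sum>i\<in>N. A i k * p j i) = A j k - (\<Sum>i\<in>N. A i k * mv (w j) i)"
    unfolding p_def using finN jk
    by (simp add: right_diff_distrib sum_subtractf if_distrib[of "\<lambda>c. _ * c"] sum.delta' cong: if_cong)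
  then show ?thesis using H_w[OF jk(2), of j] by (simp add: H_def)
qed

text \<open>The normal equations give the identity \<open>|p j|^2 = p j j - lam |w j|^2\<close>,
  whose last term is dropped. The squared Hilbert-Schmidt norm is thereby reduced to a
  trace.\<close>

lemma p_norm: 
  assumes "j \<in> N"
  shows "(\<Sum>i\<in>N. (p j i)\<^sup>2) \<le> p j j"
proof -
  have 1: "(\<Sum>i\<in>N. p j i * mv (w j) i) = lam * (\<Sum>k\<in>C. (w j k)\<^sup>2)"
  proof -
    have "(\<Sum>i\<in>N. p j i * mv (w j) i) = (\<Sum>k\<in>C. w j k * (\<Sum>i\<in>N. A i k * p j i))"
      unfolding mv_def by (simp add: sum_distrib_left sum.swap[of _ N] algebra_simps)
    also have "\<dots> = (\<Sum>k\<in>C. w j k * (lam * w j k))"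
      using p_normal[OF assms] by simp
    finally show ?thesis by (simp add: sum_distrib_left power2_eq_square algebra_simps)
  qed
  have "(\<Sum>i\<in>N. (p j i)\<^sup>2) = (\<Sum>i\<in>N. p j i * (if i = j then 1 else 0) - p j i * mv (w j) i)"
    by (intro sum.cong) (auto simp: p_def power2_eq_square algebra_simps)
  also have "\<dots> = p j j - lam * (\<Sum>k\<in>C. (w j k)\<^sup>2)"
    using finN assms 1 by (simp add: sum_subtractf if_distrib[of "\<lambda>c. _ * c"] sum.delta' cong: if_cong)
  also have "\<dots> \<le> p j j" using lam_pos by (simp add: sum_nonneg)
  finally show ?thesis .
qed

lemma w_g:
  assumes "k \<in> C"
  shows "w j k = (\<Sum>l\<in>C. A j l * g (\<lambda>m. if m = k then 1 else 0) l)"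
proof -
  let ?e = "\<lambda>m. if m = k then 1 else (0::real)"
  have "w j k = (\<Sum>l\<in>C. w j l * H (g ?e) l)"
    using finC assms by (simp add: H_g if_distrib[of "\<lambda>c. _ * c"] sum.delta' cong: if_cong)
  also have "\<dots> = (\<Sum>l\<in>C. H (w j) l * g ?e l)" by (simp add: H_sym)
  finally show ?thesis by (simp add: H_w)
qed

text \<open>By cyclicity \<open>A H^-1 A^T\<close> has the trace of
  \<open>H^-1 A^T A = I - lam H^-1\<close>, and the diagonal entries of \<open>H^-1\<close> are at
  most \<open>1 / t\<close>. With \<open>lam = t / n\<close>, \<open>n\<close> rows and
  \<open>n - 2\<close> columns the bound is at most 3.\<close>

lemma trace_p: "(\<Sum>j\<in>N. p j j) \<le> real (card N) - real (card C) + lam * real (card C) / t"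
proof -
  let ?e = "\<lambda>k m. if m = k then 1 else (0::real)"
  let ?G = "\<lambda>k. g (?e k)"
  \<comment> \<open>A diagonal entry of \<open>H^-1\<close> is the energy of its own column, so it
    satisfies \<open>t * G^2 <= G\<close>.\<close>
  have Gkk: "?G k k \<le> 1 / t" if k: "k \<in> C" for k
  proof -
    have "t * (?G k k)\<^sup>2 \<le> t * (\<Sum>l\<in>C. (?G k l)\<^sup>2)"
      using t k finC by (intro mult_left_mono member_le_sum) auto
    also have "\<dots> \<le> (\<Sum>l\<in>C. H (?G k) l * ?G k l)" by (rule H_energy)
    also have "\<dots> = ?G k k"
      using finC k by (simp add: H_g if_distrib[of "\<lambda>c. c * _"] sum.delta' cong: if_cong)
    finally have "(t * ?G k k) * ?G k k \<le> 1 * ?G k k" by (simp add: power2_eq_square algebra_simps)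
    then consider "t * ?G k k \<le> 1" | "?G k k \<le> 0" by (metis mult_le_cancel_right not_le)
    then show ?thesis
    proof cases
      case 1
      then show ?thesis using t by (simp add: field_simps)
    next
      case 2
      also have "0 \<le> 1 / t" using t by simp
      finally show ?thesis .
    qed
  qed
  have "(\<Sum>j\<in>N. mv (w j) j) = (\<Sum>j\<in>N. \<Sum>k\<in>C. A j k * mv (?G k) j)"
    unfolding mv_def[of "w _"] using w_g by (simp add: mv_def)
  also have "\<dots> = (\<Sum>k\<in>C. H (?G k) k - lam * ?G k k)"
    unfolding H_def by (simp add: sum.swap[of _ N])
  also have "\<dots> = real (card C) - lam * (\<Sum>k\<in>C. ?G k k)"
    by (simp add: H_g sum_subtractf sum_distrib_left)
  finally have "(\<Sum>j\<in>N. p j j) = real (card N) - real (card C) + lam * (\<Sum>k\<in>C. ?G k k)"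
    by (simp add: p_def sum_subtractf)
  moreover have "lam * (\<Sum>k\<in>C. ?G k k) \<le> lam * (\<Sum>k\<in>C. 1 / t)"
    using lam_pos Gkk by (intro mult_left_mono sum_mono) auto
  ultimately show ?thesis by simp
qed

lemma p_hilbert_schmidt:
  "(\<Sum>j\<in>N. \<Sum>i\<in>N. (p j i)\<^sup>2) \<le> real (card N) - real (card C) + lam * real (card C) / t"
  using trace_p p_norm by (meson order_trans sum_mono)

section \<open>The Gram matrix of the ridge solutions\<close>

lemma Q_sym: "Q i j = Q j i"
  unfolding Q_def by (simp add: mult.commute)

lemma Q_nonneg: "0 \<le> Q j j"
  unfolding Q_def by (simp add: sum_nonneg)

lemma Q_cauchy: "(Q i j)\<^sup>2 \<le> Q i i * Q j j"
  unfolding Q_def using Cauchy_Schwarz_ineq_sum[of "w i" "w j" C] by (simp add: power2_eq_square)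

lemma sum_w_expand:
  "finite J \<Longrightarrow> (\<Sum>k\<in>C. (\<Sum>j\<in>J. x j * w j k)\<^sup>2) = (\<Sum>i\<in>J. \<Sum>j\<in>J. x i * x j * Q i j)"
proof -
  assume J: "finite J"
  have "(\<Sum>k\<in>C. (\<Sum>j\<in>J. x j * w j k)\<^sup>2) = (\<Sum>k\<in>C. \<Sum>i\<in>J. \<Sum>j\<in>J. x i * w i k * (x j * w j k))"
    by (simp add: power2_eq_square sum_product)
  also have "\<dots> = (\<Sum>i\<in>J. \<Sum>j\<in>J. \<Sum>k\<in>C. x i * w i k * (x j * w j k))"
    by (subst sum.swap) (simp add: sum.swap[of _ C])
  finally show ?thesis by (simp add: Q_def sum_distrib_left algebra_simps)
qed

text \<open>The combination \<open>v\<close> solves \<open>H v = A^T x\<close>. Testing with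
  \<open>v\<close> gives \<open>|A v|^2 + lam |v|^2 = <x, A v>\<close>, hence
  \<open>|A v|^2 <= |x|^2\<close>, and coercivity turns this into a bound on \<open>v\<close>.
  Equivalently, \<open>Q\<close> has operator norm at most \<open>1 / t\<close>.\<close>

lemma sum_w_bound: "t * (\<Sum>k\<in>C. (\<Sum>j\<in>N. x j * w j k)\<^sup>2) \<le> (\<Sum>j\<in>N. (x j)\<^sup>2)"
proof -
  define v where "v k = (\<Sum>j\<in>N. x j * w j k)" for k
  have Hv: "H v k = (\<Sum>j\<in>N. x j * A j k)" if "k \<in> C" for k
    unfolding v_def using that by (simp add: H_sum[OF finN] H_w)
  have "(\<Sum>k\<in>C. H v k * v k) = (\<Sum>j\<in>N. x j * mv v j)"
    unfolding mv_def by (simp add: Hv sum_distrib_left sum_distrib_right sum.swap[of _ N] algebra_simps)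
  then have "(\<Sum>i\<in>N. (mv v i)\<^sup>2) + lam * (\<Sum>k\<in>C. (v k)\<^sup>2) = (\<Sum>j\<in>N. x j * mv v j)"
    using H_inner[of v v] by (simp add: power2_eq_square)
  moreover have "lam * (\<Sum>k\<in>C. (v k)\<^sup>2) \<ge> 0" using lam_pos by (simp add: sum_nonneg)
  moreover have "(\<Sum>j\<in>N. x j * mv v j) \<le> (\<Sum>j\<in>N. ((x j)\<^sup>2 + (mv v j)\<^sup>2) / 2)"
  proof (rule sum_mono)
    fix j show "x j * mv v j \<le> ((x j)\<^sup>2 + (mv v j)\<^sup>2) / 2"
      using sum_squares_bound[of "x j" "mv v j"] by simp
  qed
  moreover have "\<dots> = (\<Sum>j\<in>N. (x j)\<^sup>2) / 2 + (\<Sum>j\<in>N. (mv v j)\<^sup>2) / 2"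
    by (simp add: sum.distrib add_divide_distrib sum_divide_distrib)
  moreover have "t * (\<Sum>k\<in>C. (v k)\<^sup>2) \<le> (\<Sum>i\<in>N. (mv v i)\<^sup>2)" unfolding mv_def by (rule coercive)
  ultimately show ?thesis unfolding v_def by linarith
qed

text \<open>Row \<open>i\<close> of \<open>Q\<close> serves as the coefficient vector in
  \<open>sum_w_bound\<close>. Its squared norm is the inner product of \<open>w i\<close> with the
  resulting combination, and after Cauchy-Schwarz one factor \<open>?s\<close> cancels.\<close>

lemma Q_row: "(\<Sum>j\<in>N. (Q i j)\<^sup>2) \<le> Q i i / t"
proof (cases "(\<Sum>j\<in>N. (Q i j)\<^sup>2) = 0")
  case True
  then show ?thesis using Q_nonneg t by simp
next
  case False
  let ?s = "\<Sum>j\<in>N. (Q i j)\<^sup>2"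
  have pos: "?s > 0" using False by (simp add: less_le sum_nonneg)
  have "?s = (\<Sum>k\<in>C. w i k * (\<Sum>j\<in>N. Q i j * w j k))"
  proof -
    have "?s = (\<Sum>j\<in>N. Q i j * (\<Sum>k\<in>C. w i k * w j k))" by (simp add: Q_def power2_eq_square)
    also have "\<dots> = (\<Sum>k\<in>C. w i k * (\<Sum>j\<in>N. Q i j * w j k))"
      by (simp add: sum_distrib_left sum.swap[of _ N] algebra_simps)
    finally show ?thesis .
  qed
  then have "?s\<^sup>2 \<le> Q i i * (\<Sum>k\<in>C. (\<Sum>j\<in>N. Q i j * w j k)\<^sup>2)"
    using Cauchy_Schwarz_ineq_sum[of "w i" "\<lambda>k. \<Sum>j\<in>N. Q i j * w j k" C]
    by (simp add: Q_def power2_eq_square)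
  also have "\<dots> \<le> Q i i * (?s / t)"
    using sum_w_bound[of "Q i"] t Q_nonneg by (intro mult_left_mono) (auto simp: field_simps)
  finally have "?s * ?s \<le> (Q i i / t) * ?s" by (simp add: power2_eq_square)
  then show ?thesis using pos by (simp only: mult_le_cancel_right_pos)
qed

text \<open>If all rows outside \<open>T\<close> annihilate \<open>u\<close>, then \<open>u\<close> is up to a small ridge error the combination
  of the vectors \<open>w j\<close> with \<open>j \<in> T\<close>, which therefore cannot all be short.\<close>

lemma few_short_w:
  assumes T: "T \<subseteq> N" and u: "(\<Sum>k\<in>C. (u k)\<^sup>2) = 1"
    and orth: "\<And>i. i \<in> N - T \<Longrightarrow> (\<Sum>k\<in>C. A i k * u k) = 0"
    and short: "\<And>j. j \<in> T \<Longrightarrow> Q j j \<le> c" and t2: "2 * lam \<le> t"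
  shows "1 / 4 \<le> real (card T) * c * (\<Sum>j\<in>T. (\<Sum>k\<in>C. A j k * u k)\<^sup>2)"
proof -
  have finT: "finite T" using T finN finite_subset by blast
  \<comment> \<open>\<open>y\<close> solves \<open>H y = A^T A u\<close>, since the rows outside
    \<open>T\<close> annihilate \<open>u\<close>. Hence \<open>H (u - y) = lam u\<close>, and the
    norm of \<open>u - y\<close> is at most \<open>lam / t <= 1 / 2\<close>.\<close>
  define y where "y k = (\<Sum>j\<in>T. mv u j * w j k)" for k
  have "H y k = (\<Sum>j\<in>N. A j k * mv u j)" if "k \<in> C" for k
  proof -
    have "H y k = (\<Sum>j\<in>T. mv u j * A j k)"
      unfolding y_def using that by (simp add: H_sum[OF finT] H_w)
    also have "\<dots> = (\<Sum>j\<in>N. mv u j * A j k)"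
      using T finN orth by (intro sum.mono_neutral_left) (auto simp: mv_def)
    finally show ?thesis by (simp add: mult.commute)
  qed
  then have "H (\<lambda>k. u k - y k) k = lam * u k" if "k \<in> C" for k
    using that unfolding H_diff by (simp add: H_def)
  then have "t\<^sup>2 * (\<Sum>k\<in>C. (u k - y k)\<^sup>2) \<le> lam\<^sup>2"
    using H_bound[of "\<lambda>k. u k - y k"] u by (simp add: power_mult_distrib flip: sum_distrib_left)
  also have "\<dots> \<le> t\<^sup>2 / 4"
    using power_mono[OF t2, of 2] lam_pos by (simp add: power_mult_distrib)
  finally have "t\<^sup>2 * (\<Sum>k\<in>C. (u k - y k)\<^sup>2) \<le> t\<^sup>2 * (1 / 4)" by simp
  then have near: "(\<Sum>k\<in>C. (u k - y k)\<^sup>2) \<le> 1 / 4" using t by (simp only: mult_le_cancel_left_pos zero_less_power)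
  have "(\<Sum>k\<in>C. (u k)\<^sup>2) \<le> (\<Sum>k\<in>C. 2 * (y k)\<^sup>2 + 2 * (u k - y k)\<^sup>2)"
  proof (rule sum_mono)
    fix k 
    have "0 \<le> (u k - 2 * y k)\<^sup>2" by simp
    then show "(u k)\<^sup>2 \<le> 2 * (y k)\<^sup>2 + 2 * (u k - y k)\<^sup>2" by (simp add: power2_eq_square algebra_simps)
  qed
  then have "1 / 4 \<le> (\<Sum>k\<in>C. (y k)\<^sup>2)"
    using u near by (simp add: sum.distrib flip: sum_distrib_left)
  also have "\<dots> \<le> (\<Sum>k\<in>C. real (card T) * (\<Sum>j\<in>T. (mv u j * w j k)\<^sup>2))"
    unfolding y_def using sum_squared_le_sum_of_squares[where I = T]
    by (intro sum_mono) (simp add: mult.commute)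
  also have "\<dots> = real (card T) * (\<Sum>j\<in>T. (mv u j)\<^sup>2 * Q j j)"
    by (simp add: Q_def sum_distrib_left power_mult_distrib sum.swap[of _ C] power2_eq_square algebra_simps)
  also have "\<dots> \<le> real (card T) * (\<Sum>j\<in>T. (mv u j)\<^sup>2 * c)"
    using short by (intro mult_left_mono sum_mono) auto
  finally show ?thesis by (simp add: mv_def sum_distrib_left sum_distrib_right algebra_simps)
qed

text \<open>With \<open>Q_test_converse\<close> this expresses a bound on \<open>Q j j\<close> by
  inequalities in test vectors that do not mention the inverse of \<open>H\<close>; measurability is
  derived from that form.\<close>

lemma Q_test: "(\<Sum>k\<in>C. A j k * v k)\<^sup>2 \<le> Q j j * (\<Sum>k\<in>C. (H v k)\<^sup>2)"
  using Cauchy_Schwarz_ineq_sum[of "w j" "H v" C] mv_w[of v j]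
  by (simp add: mv_def Q_def power2_eq_square)

text \<open>The extremal test vector is \<open>g (w j)\<close>, which \<open>H\<close> maps to
  \<open>w j\<close> itself. The second alternative arises when \<open>Q j j\<close> is cancelled
  from both sides.\<close>

lemma Q_test_converse:
  assumes "\<And>v. (\<Sum>k\<in>C. A j k * v k)\<^sup>2 \<le> c * (\<Sum>k\<in>C. (H v k)\<^sup>2)"
  shows "Q j j \<le> c \<or> Q j j = 0"
proof -
  have "(\<Sum>k\<in>C. w j k * H (g (w j)) k) = Q j j" by (simp add: H_g Q_def)
  moreover have "(\<Sum>k\<in>C. (H (g (w j)) k)\<^sup>2) = Q j j" by (simp add: H_g Q_def power2_eq_square)
  ultimately have "(Q j j)\<^sup>2 \<le> c * Q j j"
    using assms[of "g (w j)"] mv_w[of "g (w j)" j] by (simp add: mv_def)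
  then show ?thesis using Q_nonneg[of j] by (auto simp: power2_eq_square)
qed

end

section \<open>Sign and permutation invariant random vectors\<close>

locale gram_bound =
  fixes N :: "'a set" and Q :: "'a \<Rightarrow> 'a \<Rightarrow> real" and q :: real
  assumes finN: "finite N" and q_nonneg: "0 \<le> q"
    and Q_sym: "Q i j = Q j i"
    and Q_nonneg: "0 \<le> Q j j"
    and Q_cauchy: "(Q i j)\<^sup>2 \<le> Q i i * Q j j"
    and Q_row: "i \<in> N \<Longrightarrow> (\<Sum>j\<in>N. (Q i j)\<^sup>2) \<le> q * Q i i"
begin

lemma Q_diag_le: "j \<in> N \<Longrightarrow> Q j j \<le> q"
proof -
  assume j: "j \<in> N"
  have "(Q j j)\<^sup>2 \<le> (\<Sum>l\<in>N. (Q j l)\<^sup>2)"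
    using finN j by (intro member_le_sum) auto
  also have "\<dots> \<le> q * Q j j" by (rule Q_row[OF j])
  finally have "Q j j * Q j j \<le> q * Q j j" by (simp add: power2_eq_square)
  then show ?thesis using Q_nonneg[of j] q_nonneg by (cases "Q j j = 0") auto
qed

lemma Q_square_le: "i \<in> N \<Longrightarrow> j \<in> N \<Longrightarrow> (Q i j)\<^sup>2 \<le> q * Q i i"
  using Q_cauchy[of i j] mult_right_mono[OF Q_diag_le[of j] Q_nonneg[of i]] by (simp add: mult.commute)

text \<open>The average of the ratios \<open>(Q i l)^2 / Q i i\<close> over the indices other than
  \<open>l\<close>, with weights \<open>y i * Q i i\<close>; it is 0 if the denominator vanishes.
  Since \<open>l\<close> is left out, the weight \<open>y j\<close> disappears once \<open>j\<close>
  and \<open>l\<close> are transposed.\<close>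

definition D :: "'a \<Rightarrow> ('a \<Rightarrow> real) \<Rightarrow> real" where
  "D l y = (\<Sum>i\<in>N - {l}. y i * (Q i l)\<^sup>2) / (\<Sum>i\<in>N - {l}. y i * Q i i)"

lemma weighted_row_le:
  assumes "\<And>i. i \<in> N \<Longrightarrow> 0 \<le> y i" "l \<in> N" "I \<subseteq> N"
  shows "(\<Sum>i\<in>I. y i * (Q i l)\<^sup>2) \<le> q * (\<Sum>i\<in>I. y i * Q i i)"
proof -
  have "(\<Sum>i\<in>I. y i * (Q i l)\<^sup>2) \<le> (\<Sum>i\<in>I. y i * (q * Q i i))"
    using assms Q_square_le by (intro sum_mono mult_left_mono) auto
  then show ?thesis by (simp add: sum_distrib_left algebra_simps)
qed

lemma D_nonneg: "(\<And>i. i \<in> N \<Longrightarrow> 0 \<le> y i) \<Longrightarrow> 0 \<le> D l y"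
  unfolding D_def using Q_nonneg by (intro divide_nonneg_nonneg sum_nonneg mult_nonneg_nonneg) auto

lemma D_le:
  assumes "\<And>i. i \<in> N \<Longrightarrow> 0 \<le> y i" "l \<in> N"
  shows "D l y \<le> q"
proof -
  have d: "0 \<le> (\<Sum>i\<in>N - {l}. y i * Q i i)"
    using assms Q_nonneg by (intro sum_nonneg mult_nonneg_nonneg) auto
  show ?thesis
    unfolding D_def using weighted_row_le[where I = "N - {l}", OF assms] d q_nonneg
    by (cases "(\<Sum>i\<in>N - {l}. y i * Q i i) = 0") (auto simp: divide_le_eq)
qed

text \<open>Moving the weight at \<open>l\<close> to \<open>j\<close> at most halves the denominator, unless \<open>l\<close> alone carries
  more than half of it; the second summand pays for such \<open>l\<close>.\<close>

lemma D_transpose_le: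
  assumes y: "\<And>i. i \<in> N \<Longrightarrow> 0 \<le> y i" and j: "j \<in> N" and l: "l \<in> N"
  defines "T0 \<equiv> \<Sum>i\<in>N - {j}. y i * Q i i"
  shows "D l (y \<circ> Transposition.transpose j l) \<le> 2 * (\<Sum>i\<in>N - {j}. y i * (Q i l)\<^sup>2) / T0
    + 2 * q * (if l = j then 0 else y l * Q l l) / T0 + (Q j l)\<^sup>2 / Q j j"
proof (cases "l = j")
  case True
  have "0 \<le> T0" unfolding T0_def using y Q_nonneg by (intro sum_nonneg mult_nonneg_nonneg) auto
  moreover have "0 \<le> (\<Sum>i\<in>N - {j}. y i * (Q i j)\<^sup>2)"
    using y by (intro sum_nonneg mult_nonneg_nonneg) auto
  ultimately have "(\<Sum>i\<in>N - {j}. y i * (Q i j)\<^sup>2) / T0 \<le> 2 * (\<Sum>i\<in>N - {j}. y i * (Q i j)\<^sup>2) / T0"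
    by (intro divide_right_mono) auto
  moreover have "0 \<le> (Q j l)\<^sup>2 / Q j j" using Q_nonneg by simp
  ultimately show ?thesis using True by (simp add: D_def T0_def)
next
  case False
  define a where "a = (\<Sum>i\<in>N - {l, j}. y i * (Q i l)\<^sup>2)"
  define d where "d = (\<Sum>i\<in>N - {l, j}. y i * Q i i)"
  define b where "b = y l * (Q j l)\<^sup>2"
  define e where "e = y l * Q j j"
  define f where "f = y l * Q l l"
  have split: "N - {l} - {j} = N - {l, j}" "N - {j} - {l} = N - {l, j}" by auto
  have "(\<Sum>i\<in>N - {l}. (y \<circ> Transposition.transpose j l) i * h i) = y l * h j + (\<Sum>i\<in>N - {l, j}. y i * h i)"
    for h :: "'a \<Rightarrow> real"
  proof -
    have "(\<Sum>i\<in>N - {l, j}. (y \<circ> Transposition.transpose j l) i * h i) = (\<Sum>i\<in>N - {l, j}. y i * h i)"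
      by (intro sum.cong) (auto simp: Transposition.transpose_def)
    then show ?thesis
      using finN j False by (subst sum.remove[of _ j]) (auto simp: split)
  qed
  then have D_eq: "D l (y \<circ> Transposition.transpose j l) = (a + b) / (d + e)"
    unfolding D_def a_def b_def d_def e_def by (simp add: add.commute)
  have T0_eq: "T0 = d + f"
    unfolding T0_def d_def f_def using finN l False by (subst sum.remove[of _ l]) (auto simp: split)
  have A_eq: "(\<Sum>i\<in>N - {j}. y i * (Q i l)\<^sup>2) = a + y l * (Q l l)\<^sup>2"
    unfolding a_def using finN l False by (subst sum.remove[of _ l]) (auto simp: split)
  have yl: "0 \<le> y l" using y l by simp
  have nn: "0 \<le> a" "0 \<le> b" "0 \<le> d" "0 \<le> e" "0 \<le> f"
    unfolding a_def b_def d_def e_def f_def using y yl Q_nonneg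
    by (auto intro!: sum_nonneg mult_nonneg_nonneg)
  have aq: "a \<le> q * d" unfolding a_def d_def using weighted_row_le[where I = "N - {l, j}", OF y l] by auto
  have "b \<le> e * Q l l"
    unfolding b_def e_def using mult_left_mono[OF Q_cauchy[of j l] yl] by (simp add: algebra_simps)
  then have e0: "b = 0" if "e = 0" using that nn by simp
  \<comment> \<open>The weight moved to \<open>j\<close> is separated from the others. Vanishing
    denominators do no harm: \<open>d = 0\<close> forces \<open>a = 0\<close> by \<open>aq\<close>,
    and \<open>e = 0\<close> forces \<open>b = 0\<close> by \<open>e0\<close>.\<close>
  have "(a + b) / (d + e) \<le> a / d + b / e"
  proof -
    have "a / (d + e) \<le> a / d"
      using nn aq by (cases "d = 0") (auto intro!: divide_left_mono)
    moreover have "b / (d + e) \<le> b / e"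
      using nn e0 by (cases "e = 0") (auto intro!: divide_left_mono)
    ultimately show ?thesis by (simp add: add_divide_distrib)
  qed
  also have "b / e \<le> (Q j l)\<^sup>2 / Q j j"
    unfolding b_def e_def using Q_nonneg[of j] by (cases "y l = 0") auto
  also have "a / d \<le> 2 * a / T0 + 2 * q * f / T0"
  proof (cases "f \<le> d")
    case True
    then have "a / d \<le> 2 * a / T0"
      using nn aq unfolding T0_eq by (cases "d = 0") (auto simp: field_simps intro!: mult_left_mono)
    moreover have "0 \<le> 2 * q * f / T0" using nn q_nonneg T0_eq by simp
    ultimately show ?thesis by simp
  next
    case False
    then have T0: "T0 > 0" "T0 \<le> 2 * f" using nn by (auto simp: T0_eq)
    have "a / d \<le> q" using nn aq q_nonneg by (cases "d = 0") (auto simp: divide_le_eq)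
    also have "q \<le> 2 * q * f / T0"
      using T0 mult_left_mono[OF T0(2) q_nonneg] by (simp add: field_simps)
    finally show ?thesis using nn T0 by (simp add: add_increasing)
  qed
  also have "2 * a / T0 \<le> 2 * (a + y l * (Q l l)\<^sup>2) / T0"
    using yl nn T0_eq by (intro divide_right_mono) auto
  finally show ?thesis using False unfolding D_eq A_eq f_def by simp
qed

text \<open>Summed over \<open>l\<close>, the three terms of \<open>D_transpose_le\<close> are at
  most \<open>2 * q\<close>, \<open>2 * q\<close> and \<open>q\<close>: the first and third by the
  row bound, the second because its weights add up to \<open>T0\<close>.\<close>

lemma sum_D_transpose_le:
  assumes y: "\<And>i. i \<in> N \<Longrightarrow> 0 \<le> y i" and j: "j \<in> N"
  shows "(\<Sum>l\<in>N. D l (y \<circ> Transposition.transpose j l)) \<le> 5 * q"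
proof -
  define T0 where "T0 = (\<Sum>i\<in>N - {j}. y i * Q i i)"
  have T0: "0 \<le> T0" unfolding T0_def using y Q_nonneg by (intro sum_nonneg mult_nonneg_nonneg) auto
  have "(\<Sum>l\<in>N. D l (y \<circ> Transposition.transpose j l)) \<le> (\<Sum>l\<in>N. 2 * (\<Sum>i\<in>N - {j}. y i * (Q i l)\<^sup>2) / T0
    + 2 * q * (if l = j then 0 else y l * Q l l) / T0 + (Q j l)\<^sup>2 / Q j j)"
    unfolding T0_def by (intro sum_mono D_transpose_le y j) auto
  also have "\<dots> = 2 * (\<Sum>l\<in>N. \<Sum>i\<in>N - {j}. y i * (Q i l)\<^sup>2) / T0
    + 2 * q * (\<Sum>l\<in>N. if l = j then 0 else y l * Q l l) / T0 + (\<Sum>l\<in>N. (Q j l)\<^sup>2) / Q j j"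
    by (simp add: sum.distrib sum_divide_distrib sum_distrib_left)
  also have "(\<Sum>l\<in>N. if l = j then 0 else y l * Q l l) = T0"
    unfolding T0_def using finN by (subst sum.mono_neutral_cong_right[of N "N - {j}"]) auto
  finally have le: "(\<Sum>l\<in>N. D l (y \<circ> Transposition.transpose j l))
    \<le> 2 * (\<Sum>l\<in>N. \<Sum>i\<in>N - {j}. y i * (Q i l)\<^sup>2) / T0 + 2 * q * T0 / T0 + (\<Sum>l\<in>N. (Q j l)\<^sup>2) / Q j j" .
  have "(\<Sum>l\<in>N. \<Sum>i\<in>N - {j}. y i * (Q i l)\<^sup>2) \<le> q * T0"
  proof -
    have "(\<Sum>l\<in>N. \<Sum>i\<in>N - {j}. y i * (Q i l)\<^sup>2) = (\<Sum>i\<in>N - {j}. y i * (\<Sum>l\<in>N. (Q i l)\<^sup>2))"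
      by (simp add: sum_distrib_left sum.swap[of _ N])
    also have "\<dots> \<le> (\<Sum>i\<in>N - {j}. y i * (q * Q i i))"
      using y Q_row by (intro sum_mono mult_left_mono) auto
    finally show ?thesis by (simp add: T0_def sum_distrib_left algebra_simps)
  qed
  then have row: "2 * (\<Sum>l\<in>N. \<Sum>i\<in>N - {j}. y i * (Q i l)\<^sup>2) / T0 \<le> 2 * (q * T0) / T0"
    using T0 by (intro divide_right_mono mult_left_mono) auto
  have diag: "(\<Sum>l\<in>N. (Q j l)\<^sup>2) / Q j j \<le> q"
    using Q_row[OF j] Q_nonneg[of j] q_nonneg by (cases "Q j j = 0") (auto simp: divide_le_eq)
  have cancel: "2 * (q * T0) / T0 \<le> 2 * q" "2 * q * T0 / T0 \<le> 2 * q"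
    using q_nonneg by (cases "T0 = 0"; simp)+
  have "(\<Sum>l\<in>N. D l (y \<circ> Transposition.transpose j l)) \<le> 2 * q + 2 * q + q"
    by (rule order_trans[OF le add_mono[OF add_mono[OF order_trans[OF row cancel(1)] cancel(2)] diag]])
  then show ?thesis by simp
qed

end

section \<open>Integration under sign flips and transpositions\<close>

lemma square_sign_if: "(if P then - x else x :: real)\<^sup>2 = x\<^sup>2"
  by simp

text \<open>The invariances are given by measure preserving maps of the sample space, so that they
  act on integrals of functions of \<open>X\<close> by change of variables.\<close>

locale sign_permutation_invariant = prob_space M for M :: "'w measure" +
  fixes N :: "'a set" and X :: "'a \<Rightarrow> 'w \<Rightarrow> real"
  assumes finN: "finite N"
    and meas[measurable]: "\<And>j. j \<in> N \<Longrightarrow> X j \<in> borel_measurable M"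
    and flip: "k \<in> N \<Longrightarrow> \<exists>f\<in>measurable M M. distr M M f = M \<and>
      (\<forall>\<omega>\<in>space M. \<forall>j\<in>N. X j (f \<omega>) = (if j = k then - X j \<omega> else X j \<omega>))"
    and swap: "k \<in> N \<Longrightarrow> l \<in> N \<Longrightarrow> \<exists>f\<in>measurable M M. distr M M f = M \<and>
      (\<forall>\<omega>\<in>space M. \<forall>j\<in>N. X j (f \<omega>) = X (Transposition.transpose k l j) \<omega>)"
begin

definition S :: "'w \<Rightarrow> real" where
  "S \<omega> = (\<Sum>j\<in>N. (X j \<omega>)\<^sup>2)"

lemma S_measurable[measurable]: "S \<in> borel_measurable M"
  unfolding S_def by measurable

lemma S_nonneg: "0 \<le> S \<omega>"
  unfolding S_def by (simp add: sum_nonneg)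

lemma square_le_S: "j \<in> N \<Longrightarrow> (X j \<omega>)\<^sup>2 \<le> S \<omega>"
  unfolding S_def using finN by (intro member_le_sum) auto

lemma abs_product_le_S: "i \<in> N \<Longrightarrow> j \<in> N \<Longrightarrow> \<bar>X i \<omega> * X j \<omega>\<bar> \<le> S \<omega>"
proof -
  assume ij: "i \<in> N" "j \<in> N"
  have "2 * (\<bar>X i \<omega>\<bar> * \<bar>X j \<omega>\<bar>) \<le> (X i \<omega>)\<^sup>2 + (X j \<omega>)\<^sup>2"
    using sum_squares_bound[of "\<bar>X i \<omega>\<bar>" "\<bar>X j \<omega>\<bar>"] by simp
  then show ?thesis using square_le_S[OF ij(1), of \<omega>] square_le_S[OF ij(2), of \<omega>] by (simp add: abs_mult)
qed

lemma integral_swap: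
  fixes h :: "('a \<Rightarrow> real) \<Rightarrow> real"
  assumes "k \<in> N" "l \<in> N" and [measurable]: "(\<lambda>\<omega>. h (\<lambda>j. X j \<omega>)) \<in> borel_measurable M"
    and ext: "\<And>x y. (\<And>j. j \<in> N \<Longrightarrow> x j = y j) \<Longrightarrow> h x = h y"
  shows "(\<integral>\<omega>. h (\<lambda>j. X (Transposition.transpose k l j) \<omega>) \<partial>M) = (\<integral>\<omega>. h (\<lambda>j. X j \<omega>) \<partial>M)"
proof -
  from swap[OF assms(1,2)] obtain f where f[measurable]: "f \<in> measurable M M" and "distr M M f = M"
    and X: "\<And>\<omega> j. \<omega> \<in> space M \<Longrightarrow> j \<in> N \<Longrightarrow> X j (f \<omega>) = X (Transposition.transpose k l j) \<omega>" by blast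
  then have "(\<integral>\<omega>. h (\<lambda>j. X j \<omega>) \<partial>M) = (\<integral>\<omega>. h (\<lambda>j. X j (f \<omega>)) \<partial>M)"
    using integral_distr[of f M M "\<lambda>\<omega>. h (\<lambda>j. X j \<omega>)"] by simp
  also have "\<dots> = (\<integral>\<omega>. h (\<lambda>j. X (Transposition.transpose k l j) \<omega>) \<partial>M)"
    using X by (intro Bochner_Integration.integral_cong refl ext) auto
  finally show ?thesis by simp
qed

lemma integral_odd:
  fixes h :: "('a \<Rightarrow> real) \<Rightarrow> real"
  assumes "k \<in> N" and [measurable]: "(\<lambda>\<omega>. h (\<lambda>j. X j \<omega>)) \<in> borel_measurable M"
    and ext: "\<And>x y. (\<And>j. j \<in> N \<Longrightarrow> x j = y j) \<Longrightarrow> h x = h y"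
    and odd: "\<And>x. h (\<lambda>j. if j = k then - x j else x j) = - h x"
  shows "(\<integral>\<omega>. h (\<lambda>j. X j \<omega>) \<partial>M) = 0"
proof -
  from flip[OF assms(1)] obtain f where f[measurable]: "f \<in> measurable M M" and "distr M M f = M"
    and X: "\<And>\<omega> j. \<omega> \<in> space M \<Longrightarrow> j \<in> N \<Longrightarrow> X j (f \<omega>) = (if j = k then - X j \<omega> else X j \<omega>)" by blast
  then have "(\<integral>\<omega>. h (\<lambda>j. X j \<omega>) \<partial>M) = (\<integral>\<omega>. h (\<lambda>j. X j (f \<omega>)) \<partial>M)"
    using integral_distr[of f M M "\<lambda>\<omega>. h (\<lambda>j. X j \<omega>)"] by simp
  also have "\<dots> = (\<integral>\<omega>. h (\<lambda>j. if j = k then - X j \<omega> else X j \<omega>) \<partial>M)"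
    using X by (intro Bochner_Integration.integral_cong refl ext) auto
  also have "\<dots> = - (\<integral>\<omega>. h (\<lambda>j. X j \<omega>) \<partial>M)" by (simp add: odd)
  finally show ?thesis by simp
qed

lemma integrable_product: "i \<in> N \<Longrightarrow> j \<in> N \<Longrightarrow> integrable M (\<lambda>\<omega>. X i \<omega> * X j \<omega> / S \<omega>)"
proof (rule integrable_const_bound[where B = 1])
  assume ij: "i \<in> N" "j \<in> N"
  have "norm (X i \<omega> * X j \<omega> / S \<omega>) \<le> 1" for \<omega>
    using abs_product_le_S[OF ij, of \<omega>] S_nonneg[of \<omega>] by (auto simp: divide_le_eq_1)
  then show "AE \<omega> in M. norm (X i \<omega> * X j \<omega> / S \<omega>) \<le> 1" by simp
qed simp

text \<open>Flipping the sign of \<open>X i\<close> negates the integrand and preserves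
  \<open>S\<close>. Normalisation by \<open>S\<close> keeps the integrand bounded whatever the law
  of \<open>X\<close>.\<close>

lemma correlation_zero:
  assumes "i \<in> N" "j \<in> N" "i \<noteq> j"
  shows "(\<integral>\<omega>. X i \<omega> * X j \<omega> / S \<omega> \<partial>M) = 0"
proof -
  let ?h = "\<lambda>x :: 'a \<Rightarrow> real. x i * x j / (\<Sum>j\<in>N. (x j)\<^sup>2)"
  have "(\<integral>\<omega>. ?h (\<lambda>j. X j \<omega>) \<partial>M) = 0"
  proof (rule integral_odd[OF assms(1)])
    show "(\<lambda>\<omega>. ?h (\<lambda>j. X j \<omega>)) \<in> borel_measurable M" using assms by measurable
    show "?h x = ?h y" if "\<And>j. j \<in> N \<Longrightarrow> x j = y j" for x y using that assms by simp
    show "?h (\<lambda>j. if j = i then - x j else x j) = - ?h x" for x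
      using assms by (simp add: square_sign_if)
  qed
  then show ?thesis by (simp add: S_def)
qed

text \<open>By exchangeability the integrals agree for all indices, and they add up to the integral
  of \<open>S / S\<close>. This quotient is 0 where \<open>S\<close> vanishes, hence an inequality
  only.\<close>

lemma second_moment_le:
  assumes i: "i \<in> N"
  shows "(\<integral>\<omega>. (X i \<omega>)\<^sup>2 / S \<omega> \<partial>M) \<le> 1 / real (card N)"
proof -
  have int: "integrable M (\<lambda>\<omega>. (X j \<omega>)\<^sup>2 / S \<omega>)" if "j \<in> N" for j
    using integrable_product[OF that that] by (simp add: power2_eq_square)
  have eq: "(\<integral>\<omega>. (X j \<omega>)\<^sup>2 / S \<omega> \<partial>M) = (\<integral>\<omega>. (X i \<omega>)\<^sup>2 / S \<omega> \<partial>M)" if j: "j \<in> N" for j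
  proof -
    let ?h = "\<lambda>x :: 'a \<Rightarrow> real. (x i)\<^sup>2 / (\<Sum>j\<in>N. (x j)\<^sup>2)"
    have perm: "Transposition.transpose i j permutes N" using i j by (rule permutes_swap_id)
    have "(\<integral>\<omega>. ?h (\<lambda>k. X (Transposition.transpose i j k) \<omega>) \<partial>M) = (\<integral>\<omega>. ?h (\<lambda>j. X j \<omega>) \<partial>M)"
    proof (rule integral_swap[OF i j])
      show "(\<lambda>\<omega>. ?h (\<lambda>j. X j \<omega>)) \<in> borel_measurable M" using i by measurable
      show "?h x = ?h y" if "\<And>j. j \<in> N \<Longrightarrow> x j = y j" for x y using that i by simp
    qed
    moreover have "(\<Sum>k\<in>N. (X (Transposition.transpose i j k) \<omega>)\<^sup>2) = S \<omega>" for \<omega>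
      unfolding S_def using sum.permute[OF perm, of "\<lambda>k. (X k \<omega>)\<^sup>2"] by (simp add: o_def)
    ultimately show ?thesis by (simp add: S_def[symmetric])
  qed
  have "real (card N) * (\<integral>\<omega>. (X i \<omega>)\<^sup>2 / S \<omega> \<partial>M) = (\<Sum>j\<in>N. \<integral>\<omega>. (X j \<omega>)\<^sup>2 / S \<omega> \<partial>M)"
    by (simp add: eq)
  also have "\<dots> = (\<integral>\<omega>. (\<Sum>j\<in>N. (X j \<omega>)\<^sup>2 / S \<omega>) \<partial>M)"
    using int by (subst Bochner_Integration.integral_sum) auto
  also have "\<dots> = (\<integral>\<omega>. S \<omega> / S \<omega> \<partial>M)" unfolding sum_divide_distrib[symmetric] S_def[symmetric] ..
  also have "\<dots> \<le> (\<integral>\<omega>. 1 \<partial>M)"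
    by (intro integral_mono_AE integrable_const_bound[where B = 1]) (auto simp: divide_le_eq_1)
  also have "\<dots> = 1" by (simp add: prob_space)
  finally have "real (card N) * (\<integral>\<omega>. (X i \<omega>)\<^sup>2 / S \<omega> \<partial>M) \<le> 1" .
  moreover have "0 < card N" using finN i by (auto simp: card_gt_0_iff)
  ultimately show ?thesis by (simp add: field_simps)
qed

text \<open>Sign flips leave only the diagonal, so a normalised form costs its trace divided by
  \<open>card N\<close>. It is applied to the squared residual and to the weight on the short
  indices.\<close>

lemma quadratic_form:
  fixes K :: "'a \<Rightarrow> 'a \<Rightarrow> real"
  shows integrable_quadratic_form: "integrable M (\<lambda>\<omega>. (\<Sum>i\<in>N. \<Sum>j\<in>N. K i j * (X i \<omega> * X j \<omega>)) / S \<omega>)"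
    and integral_quadratic_form_le: "(\<And>i. i \<in> N \<Longrightarrow> 0 \<le> K i i) \<Longrightarrow>
      (\<integral>\<omega>. (\<Sum>i\<in>N. \<Sum>j\<in>N. K i j * (X i \<omega> * X j \<omega>)) / S \<omega> \<partial>M) \<le> (\<Sum>i\<in>N. K i i) / real (card N)"
proof -
  have eq: "(\<Sum>i\<in>N. \<Sum>j\<in>N. K i j * (X i \<omega> * X j \<omega>)) / S \<omega> = (\<Sum>i\<in>N. \<Sum>j\<in>N. K i j * (X i \<omega> * X j \<omega> / S \<omega>))" for \<omega>
    by (simp add: sum_divide_distrib)
  show int: "integrable M (\<lambda>\<omega>. (\<Sum>i\<in>N. \<Sum>j\<in>N. K i j * (X i \<omega> * X j \<omega>)) / S \<omega>)"
    unfolding eq by (intro Bochner_Integration.integrable_sum integrable_mult_right integrable_product)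
  assume K: "\<And>i. i \<in> N \<Longrightarrow> 0 \<le> K i i"
  have "(\<integral>\<omega>. (\<Sum>i\<in>N. \<Sum>j\<in>N. K i j * (X i \<omega> * X j \<omega>)) / S \<omega> \<partial>M)
      = (\<Sum>i\<in>N. \<Sum>j\<in>N. K i j * (\<integral>\<omega>. X i \<omega> * X j \<omega> / S \<omega> \<partial>M))"
    unfolding eq using integrable_product
    by (simp add: Bochner_Integration.integral_sum del: times_divide_eq_right)
  also have "\<dots> = (\<Sum>i\<in>N. K i i * (\<integral>\<omega>. (X i \<omega>)\<^sup>2 / S \<omega> \<partial>M))"
  proof (rule sum.cong[OF refl])
    fix i assume i: "i \<in> N"
    have "(\<Sum>j\<in>N. K i j * (\<integral>\<omega>. X i \<omega> * X j \<omega> / S \<omega> \<partial>M))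
      = (\<Sum>j\<in>N. if j = i then K i i * (\<integral>\<omega>. (X i \<omega>)\<^sup>2 / S \<omega> \<partial>M) else 0)"
      using i correlation_zero by (intro sum.cong) (auto simp: power2_eq_square)
    then show "(\<Sum>j\<in>N. K i j * (\<integral>\<omega>. X i \<omega> * X j \<omega> / S \<omega> \<partial>M)) = K i i * (\<integral>\<omega>. (X i \<omega>)\<^sup>2 / S \<omega> \<partial>M)"
      using i finN by simp
  qed
  also have "\<dots> \<le> (\<Sum>i\<in>N. K i i * (1 / real (card N)))"
    using K second_moment_le by (intro sum_mono mult_left_mono) auto
  finally show "(\<integral>\<omega>. (\<Sum>i\<in>N. \<Sum>j\<in>N. K i j * (X i \<omega> * X j \<omega>)) / S \<omega> \<partial>M) \<le> (\<Sum>i\<in>N. K i i) / real (card N)"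
    by (simp add: sum_divide_distrib)
qed

end

section \<open>The off-diagonal part of the random Gram form\<close>

locale invariant_gram = sign_permutation_invariant M N X + gram_bound N Q q
  for M :: "'w measure" and N :: "'a set" and X Q q
begin

definition T :: "'w \<Rightarrow> real" where
  "T \<omega> = (\<Sum>j\<in>N. (X j \<omega>)\<^sup>2 * Q j j)"

definition off :: "'w \<Rightarrow> real" where
  "off \<omega> = (\<Sum>i\<in>N. \<Sum>j\<in>N - {i}. X i \<omega> * X j \<omega> * Q i j)"

lemma T_measurable[measurable]: "T \<in> borel_measurable M"
  unfolding T_def by measurable

lemma off_measurable[measurable]: "off \<in> borel_measurable M"
  unfolding off_def by measurable

lemma T_nonneg: "0 \<le> T \<omega>"
  unfolding T_def using Q_nonneg by (intro sum_nonneg mult_nonneg_nonneg) auto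

lemma abs_term_le_T:
  assumes "i \<in> N" "j \<in> N"
  shows "\<bar>X i \<omega> * X j \<omega> * Q i j\<bar> \<le> T \<omega>"
proof -
  have le: "(X k \<omega>)\<^sup>2 * Q k k \<le> T \<omega>" if "k \<in> N" for k
    unfolding T_def using finN that Q_nonneg by (intro member_le_sum mult_nonneg_nonneg) auto
  have "(X i \<omega> * X j \<omega> * Q i j)\<^sup>2 \<le> (X i \<omega> * X j \<omega>)\<^sup>2 * (Q i i * Q j j)"
    unfolding power_mult_distrib[of _ "Q i j"] by (intro mult_left_mono Q_cauchy) auto
  also have "\<dots> = ((X i \<omega>)\<^sup>2 * Q i i) * ((X j \<omega>)\<^sup>2 * Q j j)"
    by (simp add: power_mult_distrib algebra_simps)
  also have "\<dots> \<le> T \<omega> * T \<omega>"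
    using le assms T_nonneg Q_nonneg by (intro mult_mono) auto
  finally show ?thesis using T_nonneg by (metis abs_le_square_iff abs_of_nonneg power2_eq_square)
qed

text \<open>Transposing \<open>j\<close> and \<open>l\<close> keeps each integral and replaces the
  factor \<open>(X l)^2\<close> by \<open>(X j)^2\<close>. Averaged over \<open>j\<close>, the inner
  sum over \<open>l\<close> is bounded pointwise by \<open>sum_D_transpose_le\<close>, and the
  factors \<open>(X j)^2 / S\<close> add up to at most 1.\<close>

lemma sum_weighted_D_le:
  "(\<Sum>l\<in>N. \<integral>\<omega>. (X l \<omega>)\<^sup>2 / S \<omega> * D l (\<lambda>j. (X j \<omega>)\<^sup>2) \<partial>M) \<le> 5 * q / real (card N)"
  (is "?L \<le> _")
proof (cases "N = {}")
  case False
  define F where "F l x = (x l)\<^sup>2 / (\<Sum>j\<in>N. (x j)\<^sup>2) * D l (\<lambda>j. (x j)\<^sup>2)" for l x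
  let ?t = "\<lambda>j l \<omega> k. X (Transposition.transpose j l k) \<omega>"
  have meas_F: "(\<lambda>\<omega>. F l (\<lambda>j. X j \<omega>)) \<in> borel_measurable M" if "l \<in> N" for l
    unfolding F_def D_def using that by measurable
  have perm: "Transposition.transpose j l permutes N" if "j \<in> N" "l \<in> N" for j l
    using that by (rule permutes_swap_id)
  have in_N: "Transposition.transpose j l k \<in> N" if "j \<in> N" "l \<in> N" "k \<in> N" for j l k
    using permutes_in_image[OF perm[OF that(1,2)]] that(3) by blast
  have F_t: "F l (?t j l \<omega>) = (X j \<omega>)\<^sup>2 / S \<omega> * D l ((\<lambda>j. (X j \<omega>)\<^sup>2) \<circ> Transposition.transpose j l)"
    if "j \<in> N" "l \<in> N" for j l \<omega>
    unfolding F_def S_def using sum.permute[OF perm[OF that], of "\<lambda>k. (X k \<omega>)\<^sup>2"]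
    by (simp add: o_def)
  have F_t_bounds: "0 \<le> F l (?t j l \<omega>)" "F l (?t j l \<omega>) \<le> q" if "j \<in> N" "l \<in> N" for j l \<omega>
  proof -
    let ?D = "D l ((\<lambda>j. (X j \<omega>)\<^sup>2) \<circ> Transposition.transpose j l)"
    have D: "0 \<le> ?D" "?D \<le> q" using D_nonneg D_le that(2) by auto
    have "(X j \<omega>)\<^sup>2 / S \<omega> \<le> 1" "0 \<le> (X j \<omega>)\<^sup>2 / S \<omega>"
      using square_le_S[OF that(1), of \<omega>] S_nonneg[of \<omega>] by (auto simp: divide_le_eq_1)
    then have "(X j \<omega>)\<^sup>2 / S \<omega> * ?D \<le> 1 * q" using D by (intro mult_mono) auto
    then show "0 \<le> F l (?t j l \<omega>)" "F l (?t j l \<omega>) \<le> q" unfolding F_t[OF that] using D S_nonneg by auto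
  qed
  have meas_Ft: "(\<lambda>\<omega>. F l (?t j l \<omega>)) \<in> borel_measurable M" if "j \<in> N" "l \<in> N" for j l
    unfolding F_def D_def using that in_N by measurable
  have int_Ft: "integrable M (\<lambda>\<omega>. F l (?t j l \<omega>))" if "j \<in> N" "l \<in> N" for j l
    using F_t_bounds[OF that] meas_Ft[OF that] by (intro integrable_const_bound[where B = q]) auto
  have "(\<integral>\<omega>. F l (?t j l \<omega>) \<partial>M) = (\<integral>\<omega>. F l (\<lambda>j. X j \<omega>) \<partial>M)" if "j \<in> N" "l \<in> N" for j l
  proof (rule integral_swap[OF that meas_F[OF that(2)]])
    show "F l x = F l y" if "\<And>j. j \<in> N \<Longrightarrow> x j = y j" for x y
      unfolding F_def D_def using that \<open>l \<in> N\<close> by simp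
  qed
  then have "real (card N) * ?L = (\<Sum>j\<in>N. \<Sum>l\<in>N. \<integral>\<omega>. F l (?t j l \<omega>) \<partial>M)"
    by (simp add: F_def S_def)
  also have "\<dots> = (\<integral>\<omega>. (\<Sum>j\<in>N. \<Sum>l\<in>N. F l (?t j l \<omega>)) \<partial>M)"
    using int_Ft by (simp add: Bochner_Integration.integral_sum)
  also have "\<dots> \<le> (\<integral>\<omega>. 5 * q \<partial>M)"
  proof (rule integral_mono)
    show "integrable M (\<lambda>\<omega>. \<Sum>j\<in>N. \<Sum>l\<in>N. F l (?t j l \<omega>))" using int_Ft by auto
    fix \<omega>
    have "(\<Sum>j\<in>N. \<Sum>l\<in>N. F l (?t j l \<omega>))
      = (\<Sum>j\<in>N. (X j \<omega>)\<^sup>2 / S \<omega> * (\<Sum>l\<in>N. D l ((\<lambda>j. (X j \<omega>)\<^sup>2) \<circ> Transposition.transpose j l)))"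
      by (simp add: F_t sum_distrib_left)
    also have "\<dots> \<le> (\<Sum>j\<in>N. (X j \<omega>)\<^sup>2 / S \<omega> * (5 * q))"
      using S_nonneg by (intro sum_mono mult_left_mono sum_D_transpose_le) auto
    also have "\<dots> = S \<omega> / S \<omega> * (5 * q)"
      unfolding sum_distrib_right[symmetric] sum_divide_distrib[symmetric] S_def[symmetric] ..
    also have "\<dots> \<le> 1 * (5 * q)"
      using q_nonneg by (intro mult_right_mono) (auto simp: divide_le_eq_1)
    finally show "(\<Sum>j\<in>N. \<Sum>l\<in>N. F l (?t j l \<omega>)) \<le> 5 * q" by simp
  qed simp
  finally have "real (card N) * ?L \<le> 5 * q" by (simp add: prob_space)
  then show ?thesis using False finN by (simp add: field_simps card_gt_0_iff)
qed simp

text \<open>In the expanded square, sign flips annihilate every product of two index pairs unless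
  the pairs agree up to reversal. The two surviving products are equal, whence a factor 2. The
  normalisation by \<open>T * S\<close> is the one that \<open>bad_event_cover\<close> compares
  with.\<close>

lemma off_diagonal:
  shows integrable_off: "integrable M (\<lambda>\<omega>. (off \<omega>)\<^sup>2 / (T \<omega> * S \<omega>))"
    and integral_off_le: "(\<integral>\<omega>. (off \<omega>)\<^sup>2 / (T \<omega> * S \<omega>) \<partial>M) \<le> 10 * q / real (card N)"
proof -
  define P where "P = (SIGMA i:N. N - {i})"
  have finP: "finite P" unfolding P_def using finN by auto
  define Z where "Z a \<omega> = (case a of (i, j) \<Rightarrow> X i \<omega> * X j \<omega> * Q i j)" for a \<omega>
  define W where "W a b \<omega> = Z a \<omega> * Z b \<omega> / (T \<omega> * S \<omega>)" for a b \<omega>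
  have off_eq: "off \<omega> = (\<Sum>a\<in>P. Z a \<omega>)" for \<omega>
    unfolding off_def P_def Z_def using finN by (subst sum.Sigma) auto
  have off2: "(off \<omega>)\<^sup>2 / (T \<omega> * S \<omega>) = (\<Sum>a\<in>P. \<Sum>b\<in>P. W a b \<omega>)" for \<omega>
    unfolding off_eq W_def power2_eq_square sum_product sum_divide_distrib ..
  have meas_W[measurable]: "W a b \<in> borel_measurable M" if "a \<in> P" "b \<in> P" for a b
    using that unfolding W_def Z_def P_def by (auto simp: split_beta)
  have int_W: "integrable M (W a b)" if ab: "a \<in> P" "b \<in> P" for a b
  proof -
    obtain k l where kl: "b = (k, l)" "k \<in> N" "l \<in> N" using ab by (auto simp: P_def)
    \<comment> \<open>One factor is compared with \<open>T\<close> and the other with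
      \<open>S\<close>, which bounds the quotient.\<close>
    have "\<bar>W a b \<omega>\<bar> \<le> \<bar>Q k l\<bar>" for \<omega>
    proof -
      have "\<bar>Z a \<omega>\<bar> \<le> T \<omega>" using ab abs_term_le_T by (auto simp: P_def Z_def)
      moreover have "\<bar>Z b \<omega>\<bar> \<le> S \<omega> * \<bar>Q k l\<bar>"
        using abs_product_le_S[OF kl(2,3), of \<omega>] by (simp add: Z_def kl abs_mult mult_right_mono)
      ultimately have "\<bar>Z a \<omega> * Z b \<omega>\<bar> \<le> T \<omega> * (S \<omega> * \<bar>Q k l\<bar>)"
        unfolding abs_mult using T_nonneg by (intro mult_mono) auto
      then show ?thesis
        unfolding W_def using T_nonneg[of \<omega>] S_nonneg[of \<omega>]
        by (cases "T \<omega> * S \<omega> = 0") (auto simp: abs_mult divide_le_eq algebra_simps)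
    qed
    then show ?thesis using meas_W[OF ab] by (intro integrable_const_bound[where B = "\<bar>Q k l\<bar>"]) auto
  qed
  show "integrable M (\<lambda>\<omega>. (off \<omega>)\<^sup>2 / (T \<omega> * S \<omega>))"
    unfolding off2 using int_W by auto
  have W_zero: "(\<integral>\<omega>. W a b \<omega> \<partial>M) = 0" if ab: "a \<in> P" "b \<in> P" and ne: "b \<noteq> a" "b \<noteq> prod.swap a" for a b
  proof -
    obtain i j where a: "a = (i, j)" "i \<in> N" "j \<in> N" "i \<noteq> j" using ab by (auto simp: P_def)
    obtain k l where b: "b = (k, l)" "k \<in> N" "l \<in> N" "k \<noteq> l" using ab by (auto simp: P_def)
    \<comment> \<open>If both members of \<open>a\<close> occurred in \<open>b\<close>, the pairs
      would agree up to reversal. Flipping an unmatched index makes the integrand odd.\<close>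
    have "\<exists>m. (m = i \<or> m = j) \<and> m \<noteq> k \<and> m \<noteq> l" using ne a b by auto
    then obtain m where m: "m = i \<or> m = j" "m \<noteq> k" "m \<noteq> l" by blast
    let ?h = "\<lambda>x :: 'a \<Rightarrow> real. (x i * x j * Q i j) * (x k * x l * Q k l)
        / ((\<Sum>j\<in>N. (x j)\<^sup>2 * Q j j) * (\<Sum>j\<in>N. (x j)\<^sup>2))"
    have "(\<integral>\<omega>. ?h (\<lambda>j. X j \<omega>) \<partial>M) = 0"
    proof (rule integral_odd[of m])
      show "m \<in> N" using m a by auto
      show "(\<lambda>\<omega>. ?h (\<lambda>j. X j \<omega>)) \<in> borel_measurable M" using a b by measurable
      show "?h x = ?h y" if "\<And>j. j \<in> N \<Longrightarrow> x j = y j" for x y using that a b by simp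
      show "?h (\<lambda>j. if j = m then - x j else x j) = - ?h x" for x
        using m a by (auto simp: square_sign_if)
    qed
    then show ?thesis by (simp add: W_def Z_def a b T_def S_def)
  qed
  have W_swap: "W a (prod.swap a) = W a a" for a
    by (cases a) (simp add: fun_eq_iff W_def Z_def Q_sym algebra_simps)
  have swap_P: "prod.swap a \<in> P" "prod.swap a \<noteq> a" if "a \<in> P" for a using that by (auto simp: P_def)
  have "(\<integral>\<omega>. (off \<omega>)\<^sup>2 / (T \<omega> * S \<omega>) \<partial>M) = (\<Sum>a\<in>P. \<Sum>b\<in>P. \<integral>\<omega>. W a b \<omega> \<partial>M)"
    unfolding off2 using int_W by (simp add: Bochner_Integration.integral_sum)
  also have "\<dots> = (\<Sum>a\<in>P. 2 * (\<integral>\<omega>. W a a \<omega> \<partial>M))"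
  proof (rule sum.cong[OF refl])
    fix a assume a: "a \<in> P"
    have "(\<Sum>b\<in>P. \<integral>\<omega>. W a b \<omega> \<partial>M) = (\<Sum>b\<in>{a, prod.swap a}. \<integral>\<omega>. W a b \<omega> \<partial>M)"
      using a finP swap_P W_zero by (intro sum.mono_neutral_right) auto
    also have "\<dots> = 2 * (\<integral>\<omega>. W a a \<omega> \<partial>M)"
      using swap_P(2)[OF a] by (subst sum.insert) (auto simp: W_swap)
    finally show "(\<Sum>b\<in>P. \<integral>\<omega>. W a b \<omega> \<partial>M) = 2 * (\<integral>\<omega>. W a a \<omega> \<partial>M)" .
  qed
  also have "\<dots> = 2 * (\<Sum>l\<in>N. \<Sum>i\<in>N - {l}. \<integral>\<omega>. W (l, i) (l, i) \<omega> \<partial>M)"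
    unfolding P_def using finN by (subst sum.Sigma) (auto simp: sum_distrib_left split_beta)
  also have "\<dots> \<le> 2 * (\<Sum>l\<in>N. \<integral>\<omega>. (X l \<omega>)\<^sup>2 / S \<omega> * D l (\<lambda>j. (X j \<omega>)\<^sup>2) \<partial>M)"
  proof (intro mult_left_mono sum_mono)
    fix l assume l: "l \<in> N"
    let ?R = "\<lambda>\<omega>. (X l \<omega>)\<^sup>2 / S \<omega> * D l (\<lambda>j. (X j \<omega>)\<^sup>2)"
    have "(\<Sum>i\<in>N - {l}. \<integral>\<omega>. W (l, i) (l, i) \<omega> \<partial>M) = (\<integral>\<omega>. (\<Sum>i\<in>N - {l}. W (l, i) (l, i) \<omega>) \<partial>M)"
      using int_W l by (subst Bochner_Integration.integral_sum) (auto simp: P_def)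
    also have "\<dots> \<le> (\<integral>\<omega>. ?R \<omega> \<partial>M)"
    proof (rule integral_mono)
      show "integrable M (\<lambda>\<omega>. \<Sum>i\<in>N - {l}. W (l, i) (l, i) \<omega>)"
        by (intro Bochner_Integration.integrable_sum int_W) (use l in \<open>auto simp: P_def\<close>)
      have R: "0 \<le> ?R \<omega>" "?R \<omega> \<le> q" for \<omega>
      proof -
        have D: "0 \<le> D l (\<lambda>j. (X j \<omega>)\<^sup>2)" "D l (\<lambda>j. (X j \<omega>)\<^sup>2) \<le> q" using D_nonneg D_le l by auto
        have "(X l \<omega>)\<^sup>2 / S \<omega> \<le> 1" "0 \<le> (X l \<omega>)\<^sup>2 / S \<omega>"
          using square_le_S[OF l, of \<omega>] S_nonneg[of \<omega>] by (auto simp: divide_le_eq_1)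
        then have "?R \<omega> \<le> 1 * q" using D by (intro mult_mono) auto
        then show "0 \<le> ?R \<omega>" "?R \<omega> \<le> q" using D S_nonneg by auto
      qed
      have "?R \<in> borel_measurable M" unfolding D_def using l by measurable
      moreover have "norm (?R \<omega>) \<le> q" for \<omega> using R[of \<omega>] by (simp only: real_norm_def abs_of_nonneg)
      ultimately show "integrable M ?R" by (intro integrable_const_bound[where B = q] AE_I2)
      fix \<omega>
      let ?d = "\<Sum>i\<in>N - {l}. (X i \<omega>)\<^sup>2 * Q i i"
      let ?u = "\<Sum>i\<in>N - {l}. (X i \<omega>)\<^sup>2 * (Q i l)\<^sup>2"
      have d: "0 \<le> ?d" using Q_nonneg by (intro sum_nonneg mult_nonneg_nonneg) auto
      have u: "0 \<le> ?u" "?u \<le> q * ?d"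
        using weighted_row_le[where I = "N - {l}" and y = "\<lambda>i. (X i \<omega>)\<^sup>2", OF _ l] by (auto simp: sum_nonneg)
      \<comment> \<open>Replacing \<open>T\<close> by the smaller denominator of \<open>D l\<close>
        does not decrease the quotient.\<close>
      have dT: "?d \<le> T \<omega>"
        unfolding T_def using finN Q_nonneg by (intro sum_mono2) auto
      have "?u / T \<omega> \<le> ?u / ?d"
        using u d dT by (cases "?d = 0") (auto intro!: divide_left_mono)
      have "(\<Sum>i\<in>N - {l}. W (l, i) (l, i) \<omega>) = (X l \<omega>)\<^sup>2 / S \<omega> * (?u / T \<omega>)"
        by (simp add: W_def Z_def power2_eq_square sum_divide_distrib sum_distrib_left Q_sym[of l] algebra_simps)
      also have "\<dots> \<le> ?R \<omega>"
        unfolding D_def using \<open>?u / T \<omega> \<le> ?u / ?d\<close> S_nonneg by (intro mult_left_mono) auto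
      finally show "(\<Sum>i\<in>N - {l}. W (l, i) (l, i) \<omega>) \<le> ?R \<omega>" .
    qed
    finally show "(\<Sum>i\<in>N - {l}. \<integral>\<omega>. W (l, i) (l, i) \<omega> \<partial>M) \<le> (\<integral>\<omega>. ?R \<omega> \<partial>M)" .
  qed simp
  also have "\<dots> \<le> 2 * (5 * q / real (card N))"
    using sum_weighted_D_le by simp
  finally show "(\<integral>\<omega>. (off \<omega>)\<^sup>2 / (T \<omega> * S \<omega>) \<partial>M) \<le> 10 * q / real (card N)" by simp
qed

end

section \<open>The test vector and measurability\<close>

context ridge
begin

definition residual :: "('a \<Rightarrow> real) \<Rightarrow> 'a \<Rightarrow> real" where
  "residual x i = (\<Sum>j\<in>N. x j * p j i)"

lemma residual_eq: "i \<in> N \<Longrightarrow> residual x i = x i - mv (\<lambda>k. \<Sum>j\<in>N. x j * w j k) i"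
  unfolding residual_def p_def using finN
  by (simp add: mv_sum right_diff_distrib sum_subtractf if_distrib[of "\<lambda>c. _ * c"] cong: if_cong)

text \<open>\<open>lower\<close> is coercivity of the full matrix at
  \<open>(1, -1, -\<beta>)\<close>, whose squared norm is \<open>2 + |\<beta>|^2\<close>. If all
  three terms were below 1, then \<open>|\<beta>|^2 = T + off > T / 2 >= c * S / 4\<close>, while
  the squared residual is below \<open>t * c * S / 4\<close>. The single inequality is ready to be
  integrated.\<close>

lemma bad_event_cover:
  assumes c: "c > 0"
    and lower: "t * (2 + (\<Sum>k\<in>C. (\<Sum>j\<in>N. x j * w j k)\<^sup>2)) \<le> (\<Sum>i\<in>N. (residual x i)\<^sup>2)"
  defines "S \<equiv> \<Sum>j\<in>N. (x j)\<^sup>2"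
    and "T \<equiv> \<Sum>j\<in>N. (x j)\<^sup>2 * Q j j"
    and "off \<equiv> \<Sum>i\<in>N. \<Sum>j\<in>N - {i}. x i * x j * Q i j"
    and "B \<equiv> {j \<in> N. Q j j \<le> c}"
  shows "1 \<le> 4 / (t * c) * ((\<Sum>i\<in>N. (residual x i)\<^sup>2) / S) + 2 * ((\<Sum>j\<in>B. (x j)\<^sup>2) / S)
    + 8 / c * (off\<^sup>2 / (T * S))"
proof (rule ccontr)
  let ?R = "\<Sum>i\<in>N. (residual x i)\<^sup>2"
  let ?W = "\<Sum>j\<in>B. (x j)\<^sup>2"
  assume neg: "\<not> ?thesis"
  have S0: "0 \<le> S" unfolding S_def by (simp add: sum_nonneg)
  have T0: "0 \<le> T" unfolding T_def using Q_nonneg by (intro sum_nonneg mult_nonneg_nonneg) auto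
  have W0: "0 \<le> ?W" by (simp add: sum_nonneg)
  have R0: "0 \<le> ?R" by (simp add: sum_nonneg)
  have "0 \<le> 4 / (t * c) * (?R / S)" "0 \<le> 2 * (?W / S)" "0 \<le> 8 / c * (off\<^sup>2 / (T * S))"
    using c t R0 W0 S0 T0 by (auto intro!: mult_nonneg_nonneg divide_nonneg_nonneg)
  with neg have lt: "4 / (t * c) * (?R / S) < 1" "2 * (?W / S) < 1" "8 / c * (off\<^sup>2 / (T * S)) < 1"
    by linarith+
  \<comment> \<open>For \<open>S = 0\<close> the quotients by \<open>S\<close> are 0 and give no
    information, but then the residual vanishes and the summand 2 contradicts
    \<open>lower\<close>.\<close>
  have S: "0 < S"
  proof (rule ccontr)
    assume "\<not> 0 < S"
    then have "S = 0" using S0 by simp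
    then have "x j = 0" if "j \<in> N" for j using that finN by (simp add: S_def sum_nonneg_eq_0_iff)
    then have "?R = 0" by (simp add: residual_def)
    moreover have "0 < t * (2 + (\<Sum>k\<in>C. (\<Sum>j\<in>N. x j * w j k)\<^sup>2))"
      using t by (intro mult_pos_pos add_pos_nonneg sum_nonneg) auto
    ultimately show False using lower by simp
  qed
  \<comment> \<open>Less than half of \<open>S\<close> lies on short indices, so the long ones yield
    \<open>T >= c * S / 2\<close>.\<close>
  have W: "2 * ?W < S" using lt(2) S by (simp add: field_simps)
  have "c * (S - ?W) = (\<Sum>j\<in>N - B. (x j)\<^sup>2 * c)"
    unfolding S_def sum_distrib_right[symmetric]
    using finN by (subst sum_diff) (auto simp: B_def)
  also have "\<dots> \<le> (\<Sum>j\<in>N - B. (x j)\<^sup>2 * Q j j)"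
    by (intro sum_mono mult_left_mono) (auto simp: B_def)
  also have "\<dots> \<le> T"
    unfolding T_def using finN Q_nonneg by (intro sum_mono2) auto
  finally have "c * (S - ?W) \<le> T" .
  moreover have "c * (S / 2) \<le> c * (S - ?W)" using W c by (intro mult_left_mono) auto
  ultimately have T: "c * S \<le> 2 * T" by simp
  moreover have "0 < c * S" using S c by simp
  ultimately have T_pos: "0 < T" by linarith
  have "8 * off\<^sup>2 < c * S * T" using lt(3) S T_pos c by (simp add: field_simps)
  also have "\<dots> \<le> 2 * T * T" using T T_pos by (intro mult_right_mono) auto
  finally have "(2 * off)\<^sup>2 < T\<^sup>2" by (simp add: power2_eq_square)
  then have off: "- T < 2 * off"
    using power2_less_imp_less[of "- (2 * off)" T] T_pos by simp
  have "(\<Sum>k\<in>C. (\<Sum>j\<in>N. x j * w j k)\<^sup>2) = T + off"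
  proof -
    have "(\<Sum>j\<in>N. x i * x j * Q i j) = (x i)\<^sup>2 * Q i i + (\<Sum>j\<in>N - {i}. x i * x j * Q i j)" if "i \<in> N" for i
      using finN that by (subst sum.remove[of N i]) (auto simp: power2_eq_square)
    then show ?thesis
      unfolding T_def off_def sum_w_expand[OF finN] by (simp add: sum.distrib)
  qed
  then have "t * (c * S / 4) \<le> t * (2 + (\<Sum>k\<in>C. (\<Sum>j\<in>N. x j * w j k)\<^sup>2))"
    using off T t by (intro mult_left_mono) auto
  also have "\<dots> \<le> ?R" by (rule lower)
  finally show False using lt(1) S c t by (simp add: field_simps)
qed

end


section \<open>Coercivity and shortness by countably many test vectors\<close>

lemma rational_sequence:
  fixes v :: "'b \<Rightarrow> real"
  shows "\<exists>r. (\<forall>m::nat. r m \<in> C \<rightarrow>\<^sub>E \<rat>) \<and> (\<forall>k\<in>C. (\<lambda>m. r m k) \<longlonglongrightarrow> v k)"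
proof -
  define q where "q k m = (SOME q. q \<in> \<rat> \<and> v k - 1 / real (Suc m) < q \<and> q < v k)" for k m
  have "\<exists>q\<in>\<rat>. v k - 1 / real (Suc m) < q \<and> q < v k" for k m
    by (rule Rats_dense_in_real) simp
  then have "\<exists>q. q \<in> \<rat> \<and> v k - 1 / real (Suc m) < q \<and> q < v k" for k m by blast
  from someI_ex[OF this] have q: "q k m \<in> \<rat>" "v k - 1 / real (Suc m) < q k m" "q k m < v k" for k m
    unfolding q_def by blast+
  define r where "r m = (\<lambda>k\<in>C. q k m)" for m
  have lim: "(\<lambda>m. q k m) \<longlonglongrightarrow> v k" for k
  proof (rule tendsto_sandwich)
    show "(\<lambda>m. v k - 1 / real (Suc m)) \<longlonglongrightarrow> v k"
      using tendsto_diff[OF tendsto_const LIMSEQ_inverse_real_of_nat, of "v k"] by (simp add: inverse_eq_divide)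
    show "(\<lambda>_. v k) \<longlonglongrightarrow> v k" by simp
    show "\<forall>\<^sub>F m in sequentially. v k - 1 / real (Suc m) \<le> q k m"
      by (rule always_eventually) (intro allI less_imp_le q(2))
    show "\<forall>\<^sub>F m in sequentially. q k m \<le> v k"
      by (rule always_eventually) (intro allI less_imp_le q(3))
  qed
  have "r m \<in> C \<rightarrow>\<^sub>E \<rat>" for m unfolding r_def using q(1) by (intro restrict_PiE_iff[THEN iffD2] ballI)
  moreover have "(\<lambda>m. r m k) \<longlonglongrightarrow> v k" if "k \<in> C" for k
    using lim[of k] that by (simp add: r_def)
  ultimately show ?thesis by blast
qed

text \<open>The operator \<open>H\<close> of \<open>ridge\<close>, made available for matrices that
  need not be coercive.\<close>

definition gram_ridge :: "'a set \<Rightarrow> 'b set \<Rightarrow> real \<Rightarrow> ('a \<times> 'b \<Rightarrow> real) \<Rightarrow> ('b \<Rightarrow> real) \<Rightarrow> 'b \<Rightarrow> real" where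
  "gram_ridge N C lam a v k = (\<Sum>i\<in>N. a (i, k) * (\<Sum>l\<in>C. a (i, l) * v l)) + lam * v k"

text \<open>For finite \<open>C\<close> there are countably many extensional rational vectors, which
  makes the condition measurable; by continuity it extends to all real vectors.\<close>

definition coercive_rat :: "'a set \<Rightarrow> 'b set \<Rightarrow> real \<Rightarrow> ('a \<times> 'b \<Rightarrow> real) \<Rightarrow> bool" where
  "coercive_rat N C t a \<longleftrightarrow> (\<forall>v\<in>C \<rightarrow>\<^sub>E \<rat>. t * (\<Sum>k\<in>C. (v k)\<^sup>2) \<le> (\<Sum>i\<in>N. (\<Sum>k\<in>C. a (i, k) * v k)\<^sup>2))"

text \<open>Under coercivity this says that the column \<open>j\<close> of the ridge pseudo-inverse has squared length
  at most \<open>c\<close>; the countable set of test vectors makes it a measurable condition on \<open>a\<close>.\<close>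

definition short_rat :: "'a set \<Rightarrow> 'b set \<Rightarrow> real \<Rightarrow> real \<Rightarrow> 'a \<Rightarrow> ('a \<times> 'b \<Rightarrow> real) \<Rightarrow> bool" where
  "short_rat N C lam c j a \<longleftrightarrow>
    (\<forall>v\<in>C \<rightarrow>\<^sub>E \<rat>. (\<Sum>k\<in>C. a (j, k) * v k)\<^sup>2 \<le> c * (\<Sum>k\<in>C. (gram_ridge N C lam a v k)\<^sup>2))"

lemma coercive_rat_imp:
  assumes "coercive_rat N C t a"
  shows "t * (\<Sum>k\<in>C. (v k)\<^sup>2) \<le> (\<Sum>i\<in>N. (\<Sum>k\<in>C. a (i, k) * v k)\<^sup>2)"
proof -
  obtain r where r: "\<And>m::nat. r m \<in> C \<rightarrow>\<^sub>E \<rat>" "\<And>k. k \<in> C \<Longrightarrow> (\<lambda>m. r m k) \<longlonglongrightarrow> v k"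
    using rational_sequence[of C v] by auto
  show ?thesis
  proof (rule LIMSEQ_le)
    show "(\<lambda>m. t * (\<Sum>k\<in>C. (r m k)\<^sup>2)) \<longlonglongrightarrow> t * (\<Sum>k\<in>C. (v k)\<^sup>2)"
      using r(2) by (intro tendsto_intros)
    show "(\<lambda>m. \<Sum>i\<in>N. (\<Sum>k\<in>C. a (i, k) * r m k)\<^sup>2) \<longlonglongrightarrow> (\<Sum>i\<in>N. (\<Sum>k\<in>C. a (i, k) * v k)\<^sup>2)"
      using r(2) by (intro tendsto_intros)
  qed (use assms r(1) in \<open>unfold coercive_rat_def, blast\<close>)
qed

lemma short_rat_imp:
  assumes "short_rat N C lam c j a"
  shows "(\<Sum>k\<in>C. a (j, k) * v k)\<^sup>2 \<le> c * (\<Sum>k\<in>C. (gram_ridge N C lam a v k)\<^sup>2)"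
proof -
  obtain r where r: "\<And>m::nat. r m \<in> C \<rightarrow>\<^sub>E \<rat>" "\<And>k. k \<in> C \<Longrightarrow> (\<lambda>m. r m k) \<longlonglongrightarrow> v k"
    using rational_sequence[of C v] by auto
  show ?thesis
  proof (rule LIMSEQ_le)
    show "(\<lambda>m. (\<Sum>k\<in>C. a (j, k) * r m k)\<^sup>2) \<longlonglongrightarrow> (\<Sum>k\<in>C. a (j, k) * v k)\<^sup>2"
      using r(2) by (intro tendsto_intros)
    show "(\<lambda>m. c * (\<Sum>k\<in>C. (gram_ridge N C lam a (r m) k)\<^sup>2)) \<longlonglongrightarrow> c * (\<Sum>k\<in>C. (gram_ridge N C lam a v k)\<^sup>2)"
      unfolding gram_ridge_def using r(2) by (intro tendsto_intros)
  qed (use assms r(1) in \<open>unfold short_rat_def, blast\<close>)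
qed

lemma (in ridge) short_rat_iff:
  assumes "0 \<le> c" and A: "A = (\<lambda>i k. a (i, k))"
  shows "short_rat N C lam c j a \<longleftrightarrow> Q j j \<le> c"
proof
  have a: "a (i, k) = A i k" for i k by (simp add: A)
  have H: "gram_ridge N C lam a v k = H v k" for v k
    unfolding gram_ridge_def H_def mv_def a ..
  {
    assume "short_rat N C lam c j a"
    from short_rat_imp[OF this] have "(\<Sum>k\<in>C. A j k * v k)\<^sup>2 \<le> c * (\<Sum>k\<in>C. (H v k)\<^sup>2)" for v
      unfolding H a .
    from Q_test_converse[OF this] show "Q j j \<le> c" using \<open>0 \<le> c\<close> by auto
  next
    assume "Q j j \<le> c"
    then have "(\<Sum>k\<in>C. A j k * v k)\<^sup>2 \<le> c * (\<Sum>k\<in>C. (H v k)\<^sup>2)" for v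
      by (rule order_trans[OF Q_test mult_right_mono]) (simp add: sum_nonneg)
    then show "short_rat N C lam c j a" unfolding short_rat_def H a by blast
  }
qed

section \<open>Independent entries\<close>

lemma second_moment_linear_form:
  fixes \<mu> :: "real measure"
  assumes "prob_space \<mu>" and int: "integrable \<mu> (\<lambda>x. x)" "integrable \<mu> (\<lambda>x. x\<^sup>2)"
    and mean: "(\<integral>x. x \<partial>\<mu>) = 0" and var: "(\<integral>x. x\<^sup>2 \<partial>\<mu>) = 1"
    and J: "finite J" "J' \<subseteq> J"
  shows "integrable (PiM J (\<lambda>_. \<mu>)) (\<lambda>y. (\<Sum>p\<in>J'. u p * y p)\<^sup>2)"
    and "(\<integral>y. (\<Sum>p\<in>J'. u p * y p)\<^sup>2 \<partial>PiM J (\<lambda>_. \<mu>)) = (\<Sum>p\<in>J'. (u p)\<^sup>2)"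
proof -
  interpret prob_space \<mu> by fact
  interpret product_sigma_finite "\<lambda>_. \<mu>" by standard
  let ?M = "PiM J (\<lambda>_. \<mu>)"
  have J': "finite J'" using J finite_subset by blast
  \<comment> \<open>This writes \<open>y p * y q\<close> as a product of one function per
    coordinate, so that the integral factors over the product measure; for \<open>p = q\<close> that
    coordinate carries the square.\<close>
  define f where "f p q i x = (if i = p then x else 1) * (if i = q then x else (1 :: real))"
    for p q i :: 'a and x
  have int_f: "integrable \<mu> (f p q i)" for p q i
    using int unfolding f_def by (cases "i = p"; cases "i = q") (auto simp: power2_eq_square)
  have prod_f: "(\<Prod>i\<in>J. f p q i (y i)) = y p * y q" if "p \<in> J" "q \<in> J" for p q y
    unfolding f_def prod.distrib using J(1) that by simp
  have int2: "integrable ?M (\<lambda>y. y p * y q)" if "p \<in> J" "q \<in> J" for p q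
    using product_integrable_prod[OF J(1), of "f p q"] int_f prod_f[OF that] by simp
  have E: "(\<integral>y. y p * y q \<partial>?M) = (if p = q then 1 else 0)" if pq: "p \<in> J" "q \<in> J" for p q
  proof -
    have "(\<integral>y. y p * y q \<partial>?M) = (\<Prod>i\<in>J. \<integral>x. f p q i x \<partial>\<mu>)"
      using product_integral_prod[OF J(1), of "f p q"] int_f prod_f[OF pq] by simp
    also have "\<dots> = (if p = q then 1 else 0)"
    proof (cases "p = q")
      case True
      have "(\<integral>x. f p q i x \<partial>\<mu>) = 1" for i
        using var True unfolding f_def by (cases "i = p") (auto simp: power2_eq_square prob_space)
      then show ?thesis using True by simp
    next
      case False
      have "(\<integral>x. f p q p x \<partial>\<mu>) = 0" using mean False by (simp add: f_def)
      then show ?thesis using False J(1) pq(1) by (auto intro!: prod_zero)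
    qed
    finally show ?thesis .
  qed
  have eq: "(\<Sum>p\<in>J'. u p * y p)\<^sup>2 = (\<Sum>p\<in>J'. \<Sum>q\<in>J'. (u p * u q) * (y p * y q))" for y
    unfolding power2_eq_square sum_product by (intro sum.cong refl) (simp add: algebra_simps)
  have int_term: "integrable ?M (\<lambda>y. (u p * u q) * (y p * y q))" if "p \<in> J'" "q \<in> J'" for p q
    using int2[of p q] that J(2) by (intro integrable_mult_right) auto
  show "integrable ?M (\<lambda>y. (\<Sum>p\<in>J'. u p * y p)\<^sup>2)"
    unfolding eq by (intro Bochner_Integration.integrable_sum int_term)
  have "(\<integral>y. (\<Sum>p\<in>J'. u p * y p)\<^sup>2 \<partial>?M) = (\<Sum>p\<in>J'. \<Sum>q\<in>J'. \<integral>y. (u p * u q) * (y p * y q) \<partial>?M)"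
    unfolding eq
    by (subst Bochner_Integration.integral_sum)
      (intro Bochner_Integration.integrable_sum sum.cong refl Bochner_Integration.integral_sum int_term; assumption)+
  also have "\<dots> = (\<Sum>p\<in>J'. \<Sum>q\<in>J'. (u p * u q) * (if p = q then 1 else 0))"
  proof (intro sum.cong refl)
    fix p q assume "p \<in> J'" "q \<in> J'"
    then have "p \<in> J" "q \<in> J" using J(2) by auto
    then show "(\<integral>y. (u p * u q) * (y p * y q) \<partial>?M) = (u p * u q) * (if p = q then 1 else 0)"
      by (simp only: integral_mult_right_zero E)
  qed
  also have "\<dots> = (\<Sum>p\<in>J'. (u p)\<^sup>2)"
    using J' by (simp add: power2_eq_square if_distrib[of "\<lambda>c. _ * c"] cong: if_cong)
  finally show "(\<integral>y. (\<Sum>p\<in>J'. u p * y p)\<^sup>2 \<partial>?M) = (\<Sum>p\<in>J'. (u p)\<^sup>2)" .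
qed

lemma borel_component:
  assumes "sets \<mu> = sets borel" "p \<in> I"
  shows "(\<lambda>a. a p) \<in> borel_measurable (PiM I (\<lambda>_. \<mu>))"
  using measurable_component_singleton[OF assms(2), of "\<lambda>_. \<mu>"] assms(1)
  by (simp cong: measurable_cong_sets)

lemma countable_rational_vectors: "finite C \<Longrightarrow> countable (C \<rightarrow>\<^sub>E (\<rat> :: real set))"
  by (intro countable_PiE countable_rat)

lemma pred_countable_Ball:
  assumes "countable X" "\<And>i. i \<in> X \<Longrightarrow> Measurable.pred M (P i)"
  shows "Measurable.pred M (\<lambda>x. \<forall>i\<in>X. P i x)"
proof (cases "X = {}")
  case False
  then have "(\<forall>i\<in>X. P i x) \<longleftrightarrow> (\<forall>n. P (from_nat_into X n) x)" for x
    using assms(1) by (metis from_nat_into from_nat_into_surj)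
  moreover have [measurable]: "Measurable.pred M (P (from_nat_into X n))" for n
    using assms(2) from_nat_into[OF False] .
  ultimately show ?thesis by simp
qed simp

lemma coercive_short_measurable:
  fixes \<mu> :: "real measure"
  assumes fin: "finite N" "finite C" and sets_\<mu>: "sets \<mu> = sets borel" and j: "j \<in> N"
  shows "Measurable.pred (PiM (N \<times> C) (\<lambda>_. \<mu>)) (coercive_rat N C t)"
    and "Measurable.pred (PiM (N \<times> C) (\<lambda>_. \<mu>)) (short_rat N C lam c j)"
proof -
  have [measurable]: "(\<lambda>a. a (i, k)) \<in> borel_measurable (PiM (N \<times> C) (\<lambda>_. \<mu>))" if "i \<in> N" "k \<in> C" for i k
    using that by (intro borel_component sets_\<mu>) auto
  show "Measurable.pred (PiM (N \<times> C) (\<lambda>_. \<mu>)) (coercive_rat N C t)"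
    unfolding coercive_rat_def
    by (intro pred_countable_Ball countable_rational_vectors fin) measurable
  have forms: "(\<lambda>a. (\<Sum>k\<in>C. a (i, k) * v k)\<^sup>2) \<in> borel_measurable (PiM (N \<times> C) (\<lambda>_. \<mu>))"
    "(\<lambda>a. (\<Sum>k\<in>C. ((\<Sum>i\<in>N. a (i, k) * (\<Sum>l\<in>C. a (i, l) * v l)) + lam * v k)\<^sup>2)) \<in> borel_measurable (PiM (N \<times> C) (\<lambda>_. \<mu>))"
    if "i \<in> N" for i v
    using that by measurable
  show "Measurable.pred (PiM (N \<times> C) (\<lambda>_. \<mu>)) (short_rat N C lam c j)"
    unfolding short_rat_def gram_ridge_def
    by (intro pred_countable_Ball countable_rational_vectors fin; unfold pred_def)
      (intro borel_measurable_le borel_measurable_times borel_measurable_const forms[OF j])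
qed

text \<open>Tonelli for a splitting of the entries: one block is frozen while the other is
  integrated.\<close>

lemma emeasure_PiM_union:
  fixes \<mu> :: "'a measure"
  assumes "prob_space \<mu>" "finite I" "finite J" "I \<inter> J = {}" "E \<in> sets (PiM (I \<union> J) (\<lambda>_. \<mu>))"
  shows "emeasure (PiM (I \<union> J) (\<lambda>_. \<mu>)) E =
    (\<integral>\<^sup>+x. \<integral>\<^sup>+y. indicator E (merge I J (x, y)) \<partial>PiM J (\<lambda>_. \<mu>) \<partial>PiM I (\<lambda>_. \<mu>))"
proof -
  interpret prob_space \<mu> by fact
  interpret product_sigma_finite "\<lambda>_. \<mu>" by standard
  have "emeasure (PiM (I \<union> J) (\<lambda>_. \<mu>)) E = (\<integral>\<^sup>+x. indicator E x \<partial>PiM (I \<union> J) (\<lambda>_. \<mu>))"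
    using assms(5) by simp
  then show ?thesis
    using product_nn_integral_fold[OF assms(4,2,3), of "indicator E"] assms(5) by simp
qed

text \<open>Condition on the rows outside \<open>T\<close>: they leave room for a unit vector \<open>u\<close> orthogonal to all of
  them, and \<open>few_short_w\<close> then forces one of the variables \<open>\<langle>row j, u\<rangle>\<close>, \<open>j \<in> T\<close>, to be large.\<close>

lemma prob_few_short:
  fixes \<mu> :: "real measure" and N :: "'a set" and C :: "'b set"
  assumes prob: "prob_space \<mu>" and sets_\<mu>: "sets \<mu> = sets borel"
    and int: "integrable \<mu> (\<lambda>x. x)" "integrable \<mu> (\<lambda>x. x\<^sup>2)"
    and mean: "(\<integral>x. x \<partial>\<mu>) = 0" and var: "(\<integral>x. x\<^sup>2 \<partial>\<mu>) = 1"
    and fin: "finite N" "finite C" and T: "T \<subseteq> N" "T \<noteq> {}" and card: "card (N - T) < card C"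
    and lam: "lam > 0" and lam_t: "2 * lam \<le> t" and c: "c > 0"
  shows "emeasure (PiM (N \<times> C) (\<lambda>_. \<mu>))
      {a \<in> space (PiM (N \<times> C) (\<lambda>_. \<mu>)). coercive_rat N C t a \<and> (\<forall>j\<in>T. short_rat N C lam c j a)}
    \<le> ennreal (4 * (real (card T))\<^sup>2 * c)"
    (is "emeasure ?M ?E \<le> _")
proof -
  interpret prob_space \<mu> by fact
  let ?I = "(N - T) \<times> C" and ?J = "T \<times> C"
  have finT: "finite T" using T fin finite_subset by blast
  have un: "?I \<union> ?J = N \<times> C" using T by auto
  interpret PI: prob_space "PiM ?I (\<lambda>_. \<mu>)" by (intro prob_space_PiM prob)
  have [measurable]: "Measurable.pred ?M (coercive_rat N C t)"
    using T coercive_short_measurable(1)[OF fin sets_\<mu>] by auto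
  have [measurable]: "Measurable.pred ?M (short_rat N C lam c j)" if "j \<in> T" for j
    using T that coercive_short_measurable(2)[OF fin sets_\<mu>] by auto
  have E: "?E \<in> sets ?M"
    using finT by measurable
  have inner: "(\<integral>\<^sup>+y. indicator ?E (merge ?I ?J (x, y)) \<partial>PiM ?J (\<lambda>_. \<mu>)) \<le> ennreal (4 * (real (card T))\<^sup>2 * c)" for x
  proof -
    \<comment> \<open>Fewer rows than columns leave a nonzero vector orthogonal to the rows outside
      \<open>T\<close>. It depends on \<open>x\<close> alone and stays fixed while the rows in
      \<open>T\<close> are integrated.\<close>
    from underdetermined_system[OF _ fin(2) card, of "\<lambda>i k. x (i, k)"] fin obtain z
      where z: "\<exists>k\<in>C. z k \<noteq> 0" "\<And>i. i \<in> N - T \<Longrightarrow> (\<Sum>k\<in>C. x (i, k) * z k) = 0" by auto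
    define s where "s = (\<Sum>k\<in>C. (z k)\<^sup>2)"
    have s: "s > 0" unfolding s_def using z(1) fin by (metis sum_pos2 zero_le_power2 zero_less_power2)
    define u where "u k = z k / sqrt s" for k
    have u1: "(\<Sum>k\<in>C. (u k)\<^sup>2) = 1"
      using s by (simp add: u_def power_divide flip: sum_divide_distrib s_def)
    have orth: "(\<Sum>k\<in>C. x (i, k) * u k) = 0" if "i \<in> N - T" for i
      using z(2)[OF that] by (simp add: u_def flip: sum_divide_distrib)
    define V where "V j y = (\<Sum>p\<in>{j} \<times> C. u (snd p) * y p)\<^sup>2" for j :: 'a and y :: "'a \<times> 'b \<Rightarrow> real"
    have V_eq: "V j y = (\<Sum>k\<in>C. y (j, k) * u k)\<^sup>2" for j y
      unfolding V_def by (simp add: sum.cartesian_product' mult.commute)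
    have V: "integrable (PiM ?J (\<lambda>_. \<mu>)) (V j)" "(\<integral>y. V j y \<partial>PiM ?J (\<lambda>_. \<mu>)) = 1" if "j \<in> T" for j
    proof -
      have sub: "finite ?J" "{j} \<times> C \<subseteq> ?J" using finT fin that by auto
      show "integrable (PiM ?J (\<lambda>_. \<mu>)) (V j)"
        unfolding V_def by (rule second_moment_linear_form(1)[OF prob int mean var sub])
      have "(\<Sum>p\<in>{j} \<times> C. (u (snd p))\<^sup>2) = 1"
        using u1 by (simp add: sum.cartesian_product')
      then show "(\<integral>y. V j y \<partial>PiM ?J (\<lambda>_. \<mu>)) = 1"
        unfolding V_def by (simp only: second_moment_linear_form(2)[OF prob int mean var sub])
    qed
    \<comment> \<open>Markov's inequality: on \<open>?E\<close> the indicator is at most the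
      multiple of the sum of the \<open>V j\<close> given by \<open>few_short_w\<close>, and each
      \<open>V j\<close> has integral 1.\<close>
    have "(\<integral>\<^sup>+y. indicator ?E (merge ?I ?J (x, y)) \<partial>PiM ?J (\<lambda>_. \<mu>))
        \<le> (\<integral>\<^sup>+y. ennreal (4 * (real (card T) * c) * (\<Sum>j\<in>T. V j y)) \<partial>PiM ?J (\<lambda>_. \<mu>))"
    proof (rule nn_integral_mono)
      fix y
      let ?a = "merge ?I ?J (x, y)"
      show "indicator ?E ?a \<le> ennreal (4 * (real (card T) * c) * (\<Sum>j\<in>T. V j y))"
      proof (cases "?a \<in> ?E")
        case True
        then interpret ridge N C "\<lambda>i k. ?a (i, k)" lam t
          using fin lam lam_t coercive_rat_imp[of N C t ?a] by unfold_locales auto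
        have a_out: "?a (i, k) = x (i, k)" if "i \<in> N - T" "k \<in> C" for i k
          using that by (simp add: merge_def)
        have a_in: "?a (i, k) = y (i, k)" if "i \<in> T" "k \<in> C" for i k
          using that by (simp add: merge_def)
        have "1 / 4 \<le> real (card T) * c * (\<Sum>j\<in>T. (\<Sum>k\<in>C. ?a (j, k) * u k)\<^sup>2)"
        proof (rule few_short_w)
          show "T \<subseteq> N" by (rule T(1))
          show "(\<Sum>k\<in>C. (u k)\<^sup>2) = 1" by (rule u1)
          show "2 * lam \<le> t" by (rule lam_t)
          show "(\<Sum>k\<in>C. ?a (i, k) * u k) = 0" if "i \<in> N - T" for i
            using orth[OF that] a_out[OF that] by simp
          show "Q j j \<le> c" if "j \<in> T" for j
            using True that c short_rat_iff[of c ?a j] by auto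
        qed
        then have "1 / 4 \<le> real (card T) * c * (\<Sum>j\<in>T. V j y)"
          using a_in by (simp add: V_eq)
        then have "ennreal 1 \<le> ennreal (4 * (real (card T) * c) * (\<Sum>j\<in>T. V j y))"
          by (intro ennreal_leI) linarith
        then show ?thesis using True by simp
      qed simp
    qed
    also have "\<dots> = ennreal (\<integral>y. 4 * (real (card T) * c) * (\<Sum>j\<in>T. V j y) \<partial>PiM ?J (\<lambda>_. \<mu>))"
    proof (rule nn_integral_eq_integral)
      show "integrable (PiM ?J (\<lambda>_. \<mu>)) (\<lambda>y. 4 * (real (card T) * c) * (\<Sum>j\<in>T. V j y))"
        using V(1) by (intro integrable_mult_right Bochner_Integration.integrable_sum)
      show "AE y in PiM ?J (\<lambda>_. \<mu>). 0 \<le> 4 * (real (card T) * c) * (\<Sum>j\<in>T. V j y)"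
        using c by (intro AE_I2 mult_nonneg_nonneg sum_nonneg) (auto simp: V_def)
    qed
    also have "(\<integral>y. 4 * (real (card T) * c) * (\<Sum>j\<in>T. V j y) \<partial>PiM ?J (\<lambda>_. \<mu>))
        = 4 * (real (card T))\<^sup>2 * c"
      using V by (simp add: Bochner_Integration.integral_sum power2_eq_square)
    finally show ?thesis .
  qed
  have "emeasure ?M ?E = (\<integral>\<^sup>+x. \<integral>\<^sup>+y. indicator ?E (merge ?I ?J (x, y)) \<partial>PiM ?J (\<lambda>_. \<mu>) \<partial>PiM ?I (\<lambda>_. \<mu>))"
    using emeasure_PiM_union[OF prob, of ?I ?J ?E] fin finT E unfolding un by auto
  also have "\<dots> \<le> (\<integral>\<^sup>+x. ennreal (4 * (real (card T))\<^sup>2 * c) \<partial>PiM ?I (\<lambda>_. \<mu>))"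
    by (intro nn_integral_mono inner)
  also have "\<dots> = ennreal (4 * (real (card T))\<^sup>2 * c)"
    by (simp add: PI.emeasure_space_1)
  finally show ?thesis .
qed

section \<open>Invariance of the difference of two independent columns\<close>

lemma PiM_permute_coordinates:
  fixes \<mu> :: "'a measure"
  assumes "prob_space \<mu>" "f permutes J"
  shows "(\<lambda>\<omega>. \<lambda>p\<in>J. \<omega> (f p)) \<in> measurable (PiM J (\<lambda>_. \<mu>)) (PiM J (\<lambda>_. \<mu>))"
    and "distr (PiM J (\<lambda>_. \<mu>)) (PiM J (\<lambda>_. \<mu>)) (\<lambda>\<omega>. \<lambda>p\<in>J. \<omega> (f p)) = PiM J (\<lambda>_. \<mu>)"
proof -
  have f: "f p \<in> J" if "p \<in> J" for p using permutes_in_image[OF assms(2)] that by blast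
  show "(\<lambda>\<omega>. \<lambda>p\<in>J. \<omega> (f p)) \<in> measurable (PiM J (\<lambda>_. \<mu>)) (PiM J (\<lambda>_. \<mu>))"
    using f by (intro measurable_restrict measurable_component_singleton) auto
  show "distr (PiM J (\<lambda>_. \<mu>)) (PiM J (\<lambda>_. \<mu>)) (\<lambda>\<omega>. \<lambda>p\<in>J. \<omega> (f p)) = PiM J (\<lambda>_. \<mu>)"
    using distr_PiM_reindex[of J "\<lambda>_. \<mu>" f J] assms f permutes_inj_on by blast
qed

lemma sign_permutation_invariant_column_difference:
  fixes \<mu> :: "real measure" and N :: "nat set"
  assumes prob: "prob_space \<mu>" and sets_\<mu>: "sets \<mu> = sets borel" and N: "finite N"
  shows "sign_permutation_invariant (PiM (N \<times> {0, 1 :: nat}) (\<lambda>_. \<mu>)) N (\<lambda>i y. y (i, 0) - y (i, 1))"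
proof -
  let ?J = "N \<times> {0, 1 :: nat}"
  let ?M = "PiM ?J (\<lambda>_. \<mu>)"
  interpret prob_space ?M by (intro prob_space_PiM prob)
  have [measurable]: "(\<lambda>a. a (i, b)) \<in> borel_measurable ?M" if "i \<in> N" "b \<in> {0, 1}" for i b
    using that by (intro borel_component sets_\<mu>) auto
  show ?thesis
  proof
    fix k assume k: "k \<in> N"
    \<comment> \<open>Exchanging the two entries of row \<open>k\<close> negates their
      difference.\<close>
    define f where "f p = (if p = (k, 0) then (k, 1) else if p = (k, 1) then (k, 0) else p)" for p :: "nat \<times> nat"
    have f: "f permutes ?J"
      using k by (intro bij_imp_permutes bij_betwI[of f _ _ f]) (auto simp: f_def)
    show "\<exists>f\<in>measurable ?M ?M. distr ?M ?M f = ?M \<and> (\<forall>\<omega>\<in>space ?M. \<forall>j\<in>N.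
        f \<omega> (j, 0) - f \<omega> (j, 1) = (if j = k then - (\<omega> (j, 0) - \<omega> (j, 1)) else \<omega> (j, 0) - \<omega> (j, 1)))"
      using PiM_permute_coordinates[OF prob f] k
      by (intro bexI[of _ "\<lambda>\<omega>. \<lambda>p\<in>?J. \<omega> (f p)"]) (auto simp: f_def)
  next
    fix k l assume kl: "k \<in> N" "l \<in> N"
    let ?t = "Transposition.transpose k l"
    \<comment> \<open>Rows \<open>k\<close> and \<open>l\<close> are exchanged in both columns. The
      guard on \<open>snd p\<close> keeps \<open>f\<close> the identity outside \<open>?J\<close>,
      as \<open>permutes\<close> demands.\<close>
    define f where "f p = (if snd p \<in> {0, 1} then (?t (fst p), snd p) else p)" for p :: "nat \<times> nat"
    have t: "?t i \<in> N \<longleftrightarrow> i \<in> N" for i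
      using permutes_in_image[OF permutes_swap_id[OF kl]] .
    have f: "f permutes ?J"
    proof (rule bij_imp_permutes)
      have inv: "f (f p) = p" for p by (simp add: f_def prod_eq_iff)
      have into: "f \<in> ?J \<rightarrow> ?J" by (auto simp: f_def t)
      show "bij_betw f ?J ?J" by (rule bij_betwI[OF into into]) (rule inv)+
      show "f p = p" if "p \<notin> ?J" for p
      proof -
        have "snd p \<in> {0, 1} \<Longrightarrow> fst p \<notin> N" using that by (cases p) auto
        then have "snd p \<in> {0, 1} \<Longrightarrow> ?t (fst p) = fst p"
          using kl by (auto intro!: transpose_apply_other)
        then show ?thesis by (cases p) (auto simp: f_def)
      qed
    qed
    show "\<exists>f\<in>measurable ?M ?M. distr ?M ?M f = ?M \<and> (\<forall>\<omega>\<in>space ?M. \<forall>j\<in>N.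
        f \<omega> (j, 0) - f \<omega> (j, 1) = \<omega> (?t j, 0) - \<omega> (?t j, 1))"
      using PiM_permute_coordinates[OF prob f]
      by (intro bexI[of _ "\<lambda>\<omega>. \<lambda>p\<in>?J. \<omega> (f p)"]) (auto simp: f_def)
  next
    show "finite N" by (rule N)
    show "(\<lambda>y. y (j, 0) - y (j, 1)) \<in> borel_measurable ?M" if "j \<in> N" for j
      using that by measurable
  qed
qed

section \<open>The smallest singular value\<close>

lemma smallest_singular_value_lower:
  fixes z :: "nat \<Rightarrow> real"
  assumes gt: "\<tau> < smallest_singular_value n A" and tau: "0 \<le> \<tau>"
  shows "\<tau>\<^sup>2 * (\<Sum>j<n. (z j)\<^sup>2) \<le> (\<Sum>i<n. (\<Sum>j<n. A i j * z j)\<^sup>2)"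
proof (cases "(\<Sum>j<n. (z j)\<^sup>2) = 0")
  case True
  then show ?thesis by (simp add: sum_nonneg)
next
  case False
  define s where "s = (\<Sum>j<n. (z j)\<^sup>2)"
  have s: "s > 0" using False unfolding s_def by (simp add: less_le sum_nonneg)
  define u where "u j = z j / sqrt s" for j
  have u: "(\<Sum>j<n. (u j)\<^sup>2) = 1"
    using s by (simp add: u_def power_divide flip: sum_divide_distrib s_def)
  have "smallest_singular_value n A \<le> sqrt (\<Sum>i<n. (\<Sum>j<n. A i j * u j)\<^sup>2)"
    unfolding smallest_singular_value_def
    by (rule cInf_lower) (use u in \<open>auto intro!: bdd_belowI[of _ 0] sum_nonneg\<close>)
  with gt have "\<tau> \<le> sqrt (\<Sum>i<n. (\<Sum>j<n. A i j * u j)\<^sup>2)" by simp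
  then have "\<tau>\<^sup>2 \<le> (sqrt (\<Sum>i<n. (\<Sum>j<n. A i j * u j)\<^sup>2))\<^sup>2"
    using tau by (rule power_mono)
  also have "\<dots> = (\<Sum>i<n. (\<Sum>j<n. A i j * u j)\<^sup>2)" by (simp add: sum_nonneg)
  also have "\<dots> = (\<Sum>i<n. (\<Sum>j<n. A i j * z j)\<^sup>2) / s"
    using s by (simp add: u_def power_divide flip: sum_divide_distrib)
  finally show ?thesis using s by (simp add: field_simps s_def)
qed

text \<open>Only triples of distinct short indices have a controlled probability, so the number
  \<open>b\<close> of short indices is traded for a count of triples. At most \<open>3 * b^2\<close>
  triples have a repetition, so \<open>b >= 6\<close> gives \<open>b^3 <= 2 * D\<close>, and
  \<open>r <= \<delta> + r^3 / \<delta>^2\<close> is applied to \<open>r = b / m\<close>. The term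
  \<open>5 / m\<close> covers \<open>b <= 5\<close>.\<close>

lemma card_le_distinct_triples:
  fixes B :: "'a set" and \<delta> m :: real
  assumes B: "finite B" and pos: "\<delta> > 0" "m > 0"
  defines "D \<equiv> card {(i, j, k) \<in> B \<times> B \<times> B. i \<noteq> j \<and> j \<noteq> k \<and> i \<noteq> k}"
  shows "card B / m \<le> 5 / m + \<delta> + 2 / (m ^ 3 * \<delta>\<^sup>2) * real D"
proof (cases "card B \<le> 5")
  case True
  then have "card B / m \<le> 5 / m" using pos by (intro divide_right_mono) auto
  moreover have "0 \<le> 2 / (m ^ 3 * \<delta>\<^sup>2) * real D" using pos by simp
  ultimately show ?thesis using pos by linarith
next
  case False
  define b where "b = real (card B)"
  let ?T = "{(i, j, k) \<in> B \<times> B \<times> B. i \<noteq> j \<and> j \<noteq> k \<and> i \<noteq> k}"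
  let ?f = "\<lambda>(i, k). (i, i, k)" and ?g = "\<lambda>(i, k). (i, k, k)" and ?h = "\<lambda>(i, k). (i, k, i)"
  let ?P = "B \<times> B"
  have fin: "finite ?T" by (rule finite_subset[of _ "B \<times> B \<times> B"]) (use B in auto)
  have "B \<times> B \<times> B \<subseteq> ?T \<union> (?f ` ?P \<union> (?g ` ?P \<union> ?h ` ?P))" by (auto simp: image_iff)
  then have "card (B \<times> B \<times> B) \<le> card (?T \<union> (?f ` ?P \<union> (?g ` ?P \<union> ?h ` ?P)))"
    using fin B by (intro card_mono) auto
  also have "\<dots> \<le> card ?T + (card (?f ` ?P) + (card (?g ` ?P) + card (?h ` ?P)))"
    by (intro order_trans[OF card_Un_le] add_left_mono)+ simp
  also have "\<dots> \<le> card ?T + (card ?P + (card ?P + card ?P))"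
    using B by (intro add_left_mono add_mono card_image_le) auto
  finally have "real (card B * (card B * card B)) \<le> real (D + 3 * (card B * card B))"
    unfolding D_def by (simp only: card_cartesian_product of_nat_le_iff)
  then have "b ^ 3 \<le> real D + 3 * b\<^sup>2" by (simp add: b_def power3_eq_cube power2_eq_square)
  moreover have "6 * b\<^sup>2 \<le> b * b\<^sup>2" using False by (intro mult_right_mono) (auto simp: b_def)
  ultimately have b3: "b ^ 3 \<le> 2 * real D" by (simp add: power3_eq_cube power2_eq_square)
  have "b / m \<le> \<delta> + (b / m) ^ 3 / \<delta>\<^sup>2"
  proof (cases "b / m \<le> \<delta>")
    case True
    moreover have "0 \<le> (b / m) ^ 3 / \<delta>\<^sup>2" using pos by (simp add: b_def)
    ultimately show ?thesis by linarith
  next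
    case False
    then have "\<delta>\<^sup>2 \<le> (b / m)\<^sup>2" using pos by (intro power_mono) auto
    then have "b / m * \<delta>\<^sup>2 \<le> b / m * (b / m)\<^sup>2" using pos by (intro mult_left_mono) (auto simp: b_def)
    then have "b / m * \<delta>\<^sup>2 \<le> (b / m) ^ 3"
      by (simp only: power3_eq_cube power2_eq_square mult.assoc)
    then have "b / m \<le> (b / m) ^ 3 / \<delta>\<^sup>2" using pos by (subst pos_le_divide_eq) simp_all
    then show ?thesis using pos by linarith
  qed
  also have "(b / m) ^ 3 / \<delta>\<^sup>2 \<le> (2 * real D) / m ^ 3 / \<delta>\<^sup>2"
    unfolding power_divide using b3 pos by (intro divide_right_mono) auto
  finally have "b / m \<le> \<delta> + 2 / (m ^ 3 * \<delta>\<^sup>2) * real D" by simp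
  moreover have "0 \<le> 5 / m" using pos by simp
  ultimately show ?thesis unfolding b_def by linarith
qed

section \<open>Conditioning on all columns but the first two\<close>

lemma conditional_bound:
  fixes \<mu> :: "real measure" and n :: nat and t c :: real and x :: "nat \<times> nat \<Rightarrow> real"
  defines "N \<equiv> {..<n}" and "C \<equiv> {2..<n}"
  defines "I \<equiv> N \<times> C" and "J \<equiv> N \<times> {0, 1 :: nat}"
  assumes prob: "prob_space \<mu>" and sets_\<mu>: "sets \<mu> = sets borel"
    and n: "2 \<le> n" and t: "t > 0" and c: "c > 0"
    and coercive: "coercive_rat N C t x"
    and E: "\<And>a (z :: nat \<Rightarrow> real). a \<in> E \<Longrightarrow> t * (\<Sum>j<n. (z j)\<^sup>2) \<le> (\<Sum>i<n. (\<Sum>j<n. a (i, j) * z j)\<^sup>2)"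
  shows "(\<integral>\<^sup>+y. indicator E (merge I J (x, y)) \<partial>PiM J (\<lambda>_. \<mu>))
    \<le> ennreal (92 / (t * c * n) + 2 * card {j \<in> N. short_rat N C (t / n) c j x} / n)"
proof -
  \<comment> \<open>Small enough that the ridge term adds at most 1 to the trace bound, which is
    then at most 3.\<close>
  define lam where "lam = t / n"
  define X where "X i y = y (i, 0) - y (i, 1)" for i :: nat and y :: "nat \<times> nat \<Rightarrow> real"
  interpret R: ridge N C "\<lambda>i k. x (i, k)" lam t
    using t n coercive_rat_imp[OF coercive] by unfold_locales (auto simp: N_def C_def lam_def)
  interpret X: sign_permutation_invariant "PiM J (\<lambda>_. \<mu>)" N X
    unfolding X_def J_def using sign_permutation_invariant_column_difference[OF prob sets_\<mu>] R.finN by blast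
  interpret P: invariant_gram "PiM J (\<lambda>_. \<mu>)" N X R.Q "1 / t"
    using R.Q_row R.Q_cauchy R.Q_nonneg R.Q_sym t R.finN by unfold_locales auto
  let ?M = "PiM J (\<lambda>_. \<mu>)"
  define B where "B = {j \<in> N. R.Q j j \<le> c}"
  have B_eq: "{j \<in> N. short_rat N C (t / n) c j x} = B"
    unfolding B_def using R.short_rat_iff[of c x] c by (auto simp: lam_def)
  have cards: "real (card N) = n" "real (card C) = real n - 2" using n by (auto simp: N_def C_def)
  define f1 where "f1 y = (\<Sum>i\<in>N. (R.residual (\<lambda>j. X j y) i)\<^sup>2) / X.S y" for y
  define f2 where "f2 y = (\<Sum>j\<in>B. (X j y)\<^sup>2) / X.S y" for y
  define f3 where "f3 y = (P.off y)\<^sup>2 / (P.T y * X.S y)" for y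
  \<comment> \<open>The squared residual is the quadratic form of the Gram matrix of the columns
    \<open>R.p j\<close>; its trace is their squared Hilbert-Schmidt norm.\<close>
  have f1: "integrable ?M f1" "(\<integral>y. f1 y \<partial>?M) \<le> 3 / n"
  proof -
    let ?K = "\<lambda>j j'. \<Sum>i\<in>N. R.p j i * R.p j' i"
    have eq: "f1 y = (\<Sum>i\<in>N. \<Sum>j\<in>N. ?K i j * (X i y * X j y)) / X.S y" for y
    proof -
      have "(\<Sum>i\<in>N. (R.residual (\<lambda>j. X j y) i)\<^sup>2)
        = (\<Sum>i\<in>N. \<Sum>j\<in>N. \<Sum>j'\<in>N. R.p j i * R.p j' i * (X j y * X j' y))"
        unfolding R.residual_def power2_eq_square sum_product
        by (intro sum.cong refl) (simp add: algebra_simps)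
      also have "\<dots> = (\<Sum>j\<in>N. \<Sum>i\<in>N. \<Sum>j'\<in>N. R.p j i * R.p j' i * (X j y * X j' y))"
        by (rule sum.swap)
      also have "\<dots> = (\<Sum>j\<in>N. \<Sum>j'\<in>N. \<Sum>i\<in>N. R.p j i * R.p j' i * (X j y * X j' y))"
        by (intro sum.cong refl sum.swap)
      finally show ?thesis unfolding f1_def by (simp add: sum_distrib_right)
    qed
    show "integrable ?M f1" unfolding eq[abs_def] by (rule X.integrable_quadratic_form)
    have "(\<integral>y. f1 y \<partial>?M) \<le> (\<Sum>i\<in>N. ?K i i) / real (card N)"
      unfolding eq by (rule X.integral_quadratic_form_le) (simp add: sum_nonneg)
    also have "(\<Sum>i\<in>N. ?K i i) \<le> real (card N) - real (card C) + lam * real (card C) / t"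
      using R.p_hilbert_schmidt by (simp add: power2_eq_square)
    also have "\<dots> \<le> 3" using n t by (simp add: cards lam_def field_simps)
    finally show "(\<integral>y. f1 y \<partial>?M) \<le> 3 / n" by (simp add: cards divide_right_mono)
  qed
  have f2: "integrable ?M f2" "(\<integral>y. f2 y \<partial>?M) \<le> card B / n"
  proof -
    let ?K = "\<lambda>i j. if i = j \<and> i \<in> B then 1 else (0 :: real)"
    have sub: "B \<subseteq> N" by (auto simp: B_def)
    have eq: "f2 y = (\<Sum>i\<in>N. \<Sum>j\<in>N. ?K i j * (X i y * X j y)) / X.S y" for y
    proof -
      have "(\<Sum>j\<in>N. ?K i j * (X i y * X j y)) = (if i \<in> B then (X i y)\<^sup>2 else 0)" if "i \<in> N" for i
        using that R.finN by (auto simp: power2_eq_square if_distrib[of "\<lambda>c. c * _"] cong: if_cong)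
      then show ?thesis unfolding f2_def using R.finN sub
        by (simp add: sum.If_cases Int_absorb1)
    qed
    show "integrable ?M f2" unfolding eq[abs_def] by (rule X.integrable_quadratic_form)
    have "(\<integral>y. f2 y \<partial>?M) \<le> (\<Sum>i\<in>N. ?K i i) / real (card N)"
      unfolding eq by (rule X.integral_quadratic_form_le) simp
    also have "(\<Sum>i\<in>N. ?K i i) = card B"
      using R.finN sub by (simp add: sum.If_cases Int_absorb1)
    finally show "(\<integral>y. f2 y \<partial>?M) \<le> card B / n" by (simp add: cards)
  qed
  have f3: "integrable ?M f3" "(\<integral>y. f3 y \<partial>?M) \<le> 10 / (t * n)"
    using P.integrable_off P.integral_off_le t by (auto simp: f3_def[abs_def] cards)
  define \<Phi> where "\<Phi> y = 4 / (t * c) * f1 y + 2 * f2 y + 8 / c * f3 y" for y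
  have nonneg: "0 \<le> \<Phi> y" for y
  proof -
    have "0 \<le> f1 y" "0 \<le> f2 y" "0 \<le> f3 y"
      unfolding f1_def f2_def f3_def using X.S_nonneg P.T_nonneg
      by (auto intro!: divide_nonneg_nonneg sum_nonneg mult_nonneg_nonneg)
    then show ?thesis unfolding \<Phi>_def using t c by simp
  qed
  have cover: "1 \<le> \<Phi> y" if y: "merge I J (x, y) \<in> E" for y
  proof -
    define \<eta> where "\<eta> j = X j y" for j
    define \<beta> where "\<beta> k = (\<Sum>j\<in>N. \<eta> j * R.w j k)" for k
    \<comment> \<open>The first two coordinates produce the column difference, the others subtract
      its ridge regression on the columns in \<open>C\<close>; the matrix therefore maps
      \<open>z\<close> to the residual.\<close>
    define z where "z k = (if k = 0 then 1 else if k = 1 then -1 else - \<beta> k)" for k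
    have split: "{..<n} = insert 0 (insert 1 C)" using n by (auto simp: C_def)
    have out: "(0::nat) \<notin> insert 1 C" "(1::nat) \<notin> C" "finite C" by (auto simp: C_def)
    have zC: "z k = - \<beta> k" if "k \<in> C" for k using that by (auto simp: z_def C_def)
    have norm_z: "(\<Sum>j<n. (z j)\<^sup>2) = 2 + (\<Sum>k\<in>C. (\<beta> k)\<^sup>2)"
      unfolding split using out zC by (simp add: z_def[of 0] z_def[of "Suc 0"])
    have row: "(\<Sum>j<n. merge I J (x, y) (i, j) * z j) = R.residual \<eta> i" if i: "i \<in> N" for i
    proof -
      have "merge I J (x, y) (i, k) = x (i, k)" if "k \<in> C" for k
        using i that by (simp add: merge_def I_def)
      moreover have "merge I J (x, y) (i, b) = y (i, b)" if "b \<in> {0, 1}" for b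
        using i that by (auto simp: merge_def I_def J_def C_def)
      ultimately have "(\<Sum>j<n. merge I J (x, y) (i, j) * z j) = y (i, 0) - y (i, 1) + (\<Sum>k\<in>C. x (i, k) * - \<beta> k)"
        unfolding split using out zC by (simp add: z_def[of 0] z_def[of "Suc 0"])
      then show ?thesis
        using R.residual_eq[OF i, of \<eta>] by (simp add: \<eta>_def X_def \<beta>_def R.mv_def sum_negf)
    qed
    have "t * (2 + (\<Sum>k\<in>C. (\<Sum>j\<in>N. \<eta> j * R.w j k)\<^sup>2)) \<le> (\<Sum>i\<in>N. (R.residual \<eta> i)\<^sup>2)"
      using E[OF y, of z] norm_z row by (simp add: \<beta>_def N_def)
    from R.bad_event_cover[OF c this] show ?thesis
      unfolding \<Phi>_def f1_def f2_def f3_def \<eta>_def B_def X.S_def P.T_def P.off_def .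
  qed
  have "(\<integral>\<^sup>+y. indicator E (merge I J (x, y)) \<partial>?M) \<le> (\<integral>\<^sup>+y. ennreal (\<Phi> y) \<partial>?M)"
    using cover by (intro nn_integral_mono) (auto simp: indicator_def)
  also have "\<dots> = ennreal (\<integral>y. \<Phi> y \<partial>?M)"
    using nonneg f1(1) f2(1) f3(1) by (intro nn_integral_eq_integral) (auto simp: \<Phi>_def)
  also have "\<dots> \<le> ennreal (92 / (t * c * n) + 2 * card B / n)"
  proof (rule ennreal_leI)
    have "(\<integral>y. \<Phi> y \<partial>?M) = 4 / (t * c) * (\<integral>y. f1 y \<partial>?M) + 2 * (\<integral>y. f2 y \<partial>?M) + 8 / c * (\<integral>y. f3 y \<partial>?M)"
      unfolding \<Phi>_def using f1(1) f2(1) f3(1) by simp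
    also have "\<dots> \<le> 4 / (t * c) * (3 / n) + 2 * (card B / n) + 8 / c * (10 / (t * n))"
      using f1(2) f2(2) f3(2) t c by (intro add_mono mult_left_mono) auto
    \<comment> \<open>Here \<open>92 = 4 * 3 + 8 * 10\<close>.\<close>
    also have "\<dots> = 92 / (t * c * n) + 2 * card B / n"
      using t c n by (simp add: field_simps)
    finally show "(\<integral>y. \<Phi> y \<partial>?M) \<le> 92 / (t * c * n) + 2 * card B / n" .
  qed
  finally show ?thesis unfolding B_eq .
qed

lemma smallest_singular_value_tail:
  fixes \<mu> :: "real measure" and n :: nat
  assumes prob: "prob_space \<mu>" and sets_\<mu>: "sets \<mu> = sets borel"
    and int: "integrable \<mu> (\<lambda>x. x)" "integrable \<mu> (\<lambda>x. x\<^sup>2)"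
    and mean: "(\<integral>x. x \<partial>\<mu>) = 0" and var: "(\<integral>x. x\<^sup>2 \<partial>\<mu>) = 1"
    and n: "3 \<le> n" and \<epsilon>: "\<epsilon> > 0"
  shows "measure (iid_matrix_measure n \<mu>) {A \<in> space (iid_matrix_measure n \<mu>).
      smallest_singular_value n (\<lambda>i j. A (i, j)) > 1 / \<epsilon>\<^sup>2 * (1 / sqrt n)}
    \<le> 238 * \<epsilon> + 10 / n"
    (is "measure ?P ?E \<le> _")
proof (cases "?E \<in> sets ?P")
  \<comment> \<open>\<open>measure\<close> is 0 on a set that is not measurable.\<close>
  case False
  then show ?thesis using \<epsilon> by (simp add: measure_notin_sets)
next
  case E_sets: True
  define N where "N = {..<n}"
  define C where "C = {2..<n}"
  define I where "I = N \<times> C"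
  define J where "J = N \<times> {0, 1 :: nat}"
  \<comment> \<open>\<open>t\<close> is the square of the threshold. With
    \<open>c = \<epsilon>^3\<close> one has \<open>t * c * n = 1 / \<epsilon>\<close>, and the order
    \<open>\<epsilon>^3\<close> of the triple probabilities absorbs the factor
    \<open>1 / \<epsilon>^2\<close> of the counting lemma.\<close>
  define t where "t = 1 / (\<epsilon> ^ 4 * n)"
  define c where "c = \<epsilon> ^ 3"
  define E where "E = ?E"
  have fin: "finite N" "finite C" "finite I" "finite J" by (auto simp: N_def C_def I_def J_def)
  have pos: "t > 0" "c > 0" using \<epsilon> n by (auto simp: t_def c_def)
  have IJ: "I \<union> J = {..<n} \<times> {..<n}" "I \<inter> J = {}" using n by (auto simp: I_def J_def N_def C_def)
  have P_eq: "?P = PiM (I \<union> J) (\<lambda>_. \<mu>)" unfolding iid_matrix_measure_def IJ ..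
  interpret P: prob_space ?P unfolding P_eq by (intro prob_space_PiM prob)
  interpret PI: prob_space "PiM I (\<lambda>_. \<mu>)" by (intro prob_space_PiM prob)
  have lower: "t * (\<Sum>j<n. (z j)\<^sup>2) \<le> (\<Sum>i<n. (\<Sum>j<n. a (i, j) * z j)\<^sup>2)" if "a \<in> E" for a and z :: "nat \<Rightarrow> real"
  proof -
    have "(1 / \<epsilon>\<^sup>2 * (1 / sqrt n))\<^sup>2 = t"
      using \<epsilon> by (simp add: t_def power_divide power_mult_distrib flip: power_mult)
    then show ?thesis
      using smallest_singular_value_lower[of "1 / \<epsilon>\<^sup>2 * (1 / sqrt n)" n "\<lambda>i j. a (i, j)" z] that
      by (simp add: E_def)
  qed
  define Tr where "Tr = {(i, j, k) \<in> N \<times> N \<times> N. i \<noteq> j \<and> j \<noteq> k \<and> i \<noteq> k}"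
  define G where "G p = (case p of (i, j, k) \<Rightarrow> {x \<in> space (PiM I (\<lambda>_. \<mu>)).
      coercive_rat N C t x \<and> (\<forall>l\<in>{i, j, k}. short_rat N C (t / n) c l x)})" for p
  have finTr: "finite Tr" unfolding Tr_def by (rule finite_subset[of _ "N \<times> N \<times> N"]) (use fin in auto)
  have "card Tr \<le> card (N \<times> N \<times> N)" unfolding Tr_def using fin by (intro card_mono) auto
  then have "real (card Tr) \<le> real (card (N \<times> N \<times> N))" by simp
  then have card_Tr: "real (card Tr) \<le> real n ^ 3"
    by (simp add: card_cartesian_product N_def power3_eq_cube)
  have G_meas: "G p \<in> sets (PiM I (\<lambda>_. \<mu>))" if p_Tr: "p \<in> Tr" for p
  proof -
    obtain i j k where p: "p = (i, j, k)" "i \<in> N" "j \<in> N" "k \<in> N"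
      using p_Tr by (cases p) (auto simp: Tr_def)
    have [measurable]: "Measurable.pred (PiM I (\<lambda>_. \<mu>)) (coercive_rat N C t)"
      unfolding I_def by (rule coercive_short_measurable(1)[OF fin(1,2) sets_\<mu> p(2)])
    have [measurable]: "Measurable.pred (PiM I (\<lambda>_. \<mu>)) (short_rat N C (t / n) c l)" if "l \<in> {i, j, k}" for l
      unfolding I_def using p that by (intro coercive_short_measurable(2)[OF fin(1,2) sets_\<mu>]) auto
    show ?thesis unfolding G_def p prod.case by measurable
  qed
  have G_prob: "emeasure (PiM I (\<lambda>_. \<mu>)) (G p) \<le> ennreal (36 * c)" if p_Tr: "p \<in> Tr" for p
  proof -
    obtain i j k where p: "p = (i, j, k)" "i \<in> N" "j \<in> N" "k \<in> N" "i \<noteq> j" "j \<noteq> k" "i \<noteq> k"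
      using p_Tr by (cases p) (auto simp: Tr_def)
    have card3: "card {i, j, k} = 3" using p by simp
    have "card (N - {i, j, k}) = n - 3" using p card3 by (subst card_Diff_subset) (auto simp: N_def)
    \<comment> \<open>Three is the least number of deleted rows that leaves fewer rows than the
      \<open>n - 2\<close> columns.\<close>
    then have "card (N - {i, j, k}) < card C" using n by (simp add: C_def)
    moreover have "0 < t / n" "2 * (t / n) \<le> t" using pos n by (auto simp: field_simps)
    ultimately have "emeasure (PiM I (\<lambda>_. \<mu>)) (G p) \<le> ennreal (4 * (real (card {i, j, k}))\<^sup>2 * c)"
      unfolding G_def p prod.case I_def using p pos
      by (intro prob_few_short[OF prob sets_\<mu> int mean var fin(1,2)]) auto
    then show ?thesis unfolding card3 by simp
  qed
  have inner: "(\<integral>\<^sup>+y. indicator E (merge I J (x, y)) \<partial>PiM J (\<lambda>_. \<mu>))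
      \<le> ennreal (94 * \<epsilon> + 10 / n) + (\<Sum>p\<in>Tr. ennreal (4 / (n ^ 3 * \<epsilon>\<^sup>2)) * indicator (G p) x)"
    if x: "x \<in> space (PiM I (\<lambda>_. \<mu>))" for x
  proof (cases "coercive_rat N C t x")
    \<comment> \<open>Extending test vectors by 0 shows that a matrix in \<open>E\<close> has a
      coercive block, so the integrand vanishes for this \<open>x\<close>.\<close>
    case False
    have "merge I J (x, y) \<notin> E" for y
    proof
      let ?a = "merge I J (x, y)"
      assume a: "?a \<in> E"
      have "t * (\<Sum>k\<in>C. (v k)\<^sup>2) \<le> (\<Sum>i\<in>N. (\<Sum>k\<in>C. x (i, k) * v k)\<^sup>2)" for v
      proof -
        let ?z = "\<lambda>k. if k \<in> C then v k else 0"
        have sub: "C \<subseteq> {..<n}" by (auto simp: C_def)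
        have "(\<Sum>j<n. (?z j)\<^sup>2) = (\<Sum>k\<in>C. (v k)\<^sup>2)"
          using sub by (intro sum.mono_neutral_cong_right) auto
        moreover have "(\<Sum>j<n. ?a (i, j) * ?z j) = (\<Sum>k\<in>C. x (i, k) * v k)" if "i \<in> N" for i
          using sub that by (intro sum.mono_neutral_cong_right) (auto simp: merge_def I_def)
        ultimately show ?thesis using lower[OF a, of ?z] by (simp add: N_def)
      qed
      with False show False unfolding coercive_rat_def by blast
    qed
    then show ?thesis by simp
  next
    case True
    define B where "B = {j \<in> N. short_rat N C (t / n) c j x}"
    have finB: "finite B" unfolding B_def using fin by simp
    let ?D = "{(i, j, k) \<in> B \<times> B \<times> B. i \<noteq> j \<and> j \<noteq> k \<and> i \<noteq> k}"
    let ?r = "4 / (real n ^ 3 * \<epsilon>\<^sup>2)"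
    have D_eq: "real (card ?D) = (\<Sum>p\<in>Tr. indicator (G p) x)"
    proof -
      have "?D = {p \<in> Tr. x \<in> G p}"
        using True x by (auto simp: Tr_def G_def B_def)
      then show ?thesis using finTr by (simp add: indicator_def sum.If_cases Int_def)
    qed
    have "(\<integral>\<^sup>+y. indicator E (merge I J (x, y)) \<partial>PiM J (\<lambda>_. \<mu>))
        \<le> ennreal (92 / (t * c * n) + 2 * card B / n)"
      unfolding I_def J_def B_def N_def C_def
      by (rule conditional_bound[OF prob sets_\<mu> _ pos])
        (use n True lower in \<open>auto simp: N_def C_def\<close>)
    also have "\<dots> \<le> ennreal ((94 * \<epsilon> + 10 / n) + ?r * real (card ?D))"
    proof (rule ennreal_leI)
      have "92 / (t * c * n) = 92 * \<epsilon>"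
        using n \<epsilon> by (simp add: t_def c_def field_simps power_numeral_reduce)
      \<comment> \<open>Used with \<open>\<delta> = \<epsilon>\<close> and doubled, this contributes
        \<open>2 * \<epsilon>\<close>, \<open>10 / n\<close> and the weighted triple count.\<close>
      moreover have "card B / n \<le> 5 / n + \<epsilon> + 2 / (real n ^ 3 * \<epsilon>\<^sup>2) * real (card ?D)"
        using card_le_distinct_triples[OF finB \<epsilon>, of n] n by simp
      ultimately show "92 / (t * c * n) + 2 * card B / n \<le> (94 * \<epsilon> + 10 / n) + ?r * real (card ?D)"
        by (simp add: field_simps)
    qed
    also have "\<dots> = ennreal (94 * \<epsilon> + 10 / n) + ennreal ?r * ennreal (real (card ?D))"
    proof -
      have nn: "0 \<le> 94 * \<epsilon> + 10 / n" "0 \<le> ?r" using \<epsilon> by auto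
      show ?thesis
        unfolding ennreal_mult[OF nn(2) of_nat_0_le_iff, symmetric]
        using nn by (intro ennreal_plus mult_nonneg_nonneg) auto
    qed
    also have "ennreal (real (card ?D)) = (\<Sum>p\<in>Tr. indicator (G p) x)"
      unfolding D_eq by (subst sum_ennreal[symmetric]) (auto simp: ennreal_indicator)
    finally show ?thesis by (simp add: sum_distrib_left)
  qed
  have "emeasure ?P E = (\<integral>\<^sup>+x. \<integral>\<^sup>+y. indicator E (merge I J (x, y)) \<partial>PiM J (\<lambda>_. \<mu>) \<partial>PiM I (\<lambda>_. \<mu>))"
    using emeasure_PiM_union[OF prob fin(3,4) IJ(2)] E_sets unfolding E_def P_eq by blast
  also have "\<dots> \<le> (\<integral>\<^sup>+x. ennreal (94 * \<epsilon> + 10 / n) + (\<Sum>p\<in>Tr. ennreal (4 / (n ^ 3 * \<epsilon>\<^sup>2)) * indicator (G p) x) \<partial>PiM I (\<lambda>_. \<mu>))"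
    by (intro nn_integral_mono inner)
  also have "\<dots> = ennreal (94 * \<epsilon> + 10 / n) + (\<Sum>p\<in>Tr. ennreal (4 / (n ^ 3 * \<epsilon>\<^sup>2)) * emeasure (PiM I (\<lambda>_. \<mu>)) (G p))"
    using G_meas by (simp add: nn_integral_add nn_integral_sum nn_integral_cmult_indicator PI.emeasure_space_1)
  also have "\<dots> \<le> ennreal (94 * \<epsilon> + 10 / n) + (\<Sum>p\<in>Tr. ennreal (4 / (n ^ 3 * \<epsilon>\<^sup>2)) * ennreal (36 * c))"
    using G_prob by (intro add_left_mono sum_mono mult_left_mono) auto
  also have "\<dots> = ennreal (94 * \<epsilon> + 10 / n + real (card Tr) * (4 / (n ^ 3 * \<epsilon>\<^sup>2) * (36 * c)))"
  proof -
    have nn: "0 \<le> 94 * \<epsilon> + 10 / n" "0 \<le> 4 / (n ^ 3 * \<epsilon>\<^sup>2)" "0 \<le> 36 * c" using \<epsilon> pos by auto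
    have "(\<Sum>p\<in>Tr. ennreal (4 / (n ^ 3 * \<epsilon>\<^sup>2)) * ennreal (36 * c))
        = ennreal (real (card Tr) * (4 / (n ^ 3 * \<epsilon>\<^sup>2) * (36 * c)))"
      unfolding ennreal_mult[OF nn(2,3), symmetric]
      using mult_nonneg_nonneg[OF nn(2,3)] by (subst sum_ennreal) auto
    then show ?thesis
      using nn mult_nonneg_nonneg[OF nn(2,3)] by (simp only: ennreal_plus mult_nonneg_nonneg of_nat_0_le_iff)
  qed
  also have "\<dots> \<le> ennreal (238 * \<epsilon> + 10 / n)"
  proof (rule ennreal_leI)
    \<comment> \<open>At most \<open>n^3\<close> triples of probability at most
      \<open>36 * c\<close> contribute \<open>144 * \<epsilon>\<close> in total, and
      \<open>94 + 144 = 238\<close>.\<close>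
    have "real (card Tr) * (4 / (n ^ 3 * \<epsilon>\<^sup>2) * (36 * c)) \<le> real n ^ 3 * (4 / (n ^ 3 * \<epsilon>\<^sup>2) * (36 * c))"
      using card_Tr \<epsilon> pos by (intro mult_right_mono) auto
    also have "\<dots> = 144 * \<epsilon>"
      using n \<epsilon> by (simp add: c_def power3_eq_cube power2_eq_square)
    finally show "94 * \<epsilon> + 10 / n + real (card Tr) * (4 / (n ^ 3 * \<epsilon>\<^sup>2) * (36 * c)) \<le> 238 * \<epsilon> + 10 / n"
      by simp
  qed
  finally show ?thesis
    using \<epsilon> unfolding E_def P.emeasure_eq_measure by (subst (asm) ennreal_le_iff) auto
qed

theorem theorem1p1:
  shows "\<exists>C>0. \<forall>n::nat. \<forall>\<mu>::real measure. \<forall>\<epsilon>::real.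
    n \<ge> 1 \<and> prob_space \<mu> \<and> sets \<mu> = sets borel \<and>
    integrable \<mu> (\<lambda>x. x) \<and> integrable \<mu> (\<lambda>x. x^2) \<and>
    (\<integral>x. x \<partial>\<mu>) = 0 \<and> (\<integral>x. x^2 \<partial>\<mu>) = 1 \<and> \<epsilon> > 0
    \<longrightarrow> measure (iid_matrix_measure n \<mu>)
          {A \<in> space (iid_matrix_measure n \<mu>).
             smallest_singular_value n (\<lambda>i j. A (i, j)) > (1 / \<epsilon>^2) * (1 / sqrt (real n))}
        \<le> C * \<epsilon> + C / sqrt (real n)"
proof (intro exI[of _ 238] conjI allI impI, simp, elim conjE)
  fix n :: nat and \<mu> :: "real measure" and \<epsilon> :: real
  assume n: "n \<ge> 1" and \<mu>: "prob_space \<mu>" "sets \<mu> = sets borel"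
    "integrable \<mu> (\<lambda>x. x)" "integrable \<mu> (\<lambda>x. x^2)" "(\<integral>x. x \<partial>\<mu>) = 0" "(\<integral>x. x^2 \<partial>\<mu>) = 1"
    and \<epsilon>: "\<epsilon> > 0"
  let ?P = "iid_matrix_measure n \<mu>"
  let ?E = "{A \<in> space ?P. smallest_singular_value n (\<lambda>i j. A (i, j)) > 1 / \<epsilon>^2 * (1 / sqrt (real n))}"
  show "measure ?P ?E \<le> 238 * \<epsilon> + 238 / sqrt (real n)"
  proof (cases "3 \<le> n")
    case True
    have "measure ?P ?E \<le> 238 * \<epsilon> + 10 / n"
      by (rule smallest_singular_value_tail[OF \<mu> True \<epsilon>])
    also have "10 / n \<le> 238 / sqrt n"
    proof (rule frac_le)
      show "sqrt n \<le> n" using n by (simp add: sqrt_le_D real_le_lsqrt self_le_power)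
    qed (use n in auto)
    finally show ?thesis by simp
  next
    case False
    interpret prob_space ?P unfolding iid_matrix_measure_def by (intro prob_space_PiM \<mu>)
    \<comment> \<open>For \<open>n <= 2\<close> the second term of the bound already exceeds
      1.\<close>
    have "measure ?P ?E \<le> 1" by (rule prob_le_1)
    also have "1 \<le> 238 / sqrt n"
      using False n real_sqrt_le_mono[of n 4] by (simp add: field_simps)
    finally show ?thesis using \<epsilon> by (simp add: add_increasing)
  qed
qed

end
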